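(* Let $\Sigma$ be a finite non-empty alphabet, $\upsilon\notin\Sigma$ a variable, $\mathcal U\subseteq W^{\omega}(\Sigma ; \upsilon)$, $\mathbf s\in W^{<\omega}(\Sigma ; \upsilon)$ and $\vec{s}\in W^{\omega}(\Sigma ; \upsilon)$. Then either there exists $\vec{u} \prec \vec{s}$ such that $[\mathbf s,\vec{u}]\subseteq \hat{\mathcal U}$, or there exists a countable ordinal $\xi_0$ (depending on $\mathcal U,\mathbf s,\vec s$) such that for every countable ordinal $\xi>\xi_0$ there exists $\vec{u} \prec \vec{s}$ with $[\mathbf s \odot \mathbf t,\ \vec{t} \setminus \mathbf t]\subseteq W^{\omega}(\Sigma ; \upsilon)\setminus \mathcal U$ for every $\vec{t} \prec \vec{u}$ and every $\mathbf t \in W^\xi(\Sigma ; \upsilon)$ which is an initial segment of $\vec{t}$.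
   Context: $\mathbb N=\{1,2,\ldots\}$. Words. $\Sigma$ is a finite non-empty alphabet and $\upsilon\notin\Sigma$ is the variable. $W(\Sigma;\upsilon)$ is the set of variable words: non-empty finite sequences of elements of $\Sigma\cup\{\upsilon\}$ in which $\upsilon$ occurs; $\ast$ is concatenation. For $w\in W(\Sigma;\upsilon)$ and $\alpha\in\Sigma\cup\{\upsilon\}$, $w(\alpha)$ is $w$ with every occurrence of $\upsilon$ replaced by $\alpha$. $W^{<\omega}(\Sigma;\upsilon)$ is the set of finite sequences (including $\emptyset$) of variable words, $W^{\omega}(\Sigma;\upsilon)$ the set of infinite sequences of variable words. If $\mathbf s=(s_1,\ldots,s_k)$ is an initial segment of $\vec w=(w_n)_{n\in\mathbb N}$ (i.e. $s_i=w_i$ for $i\le k$), written $\mathbf s\propto\vec w$, then $\vec w\setminus\mathbf s=(w_n)_{n>k}$; also $\emptyset\propto\vec w$ and $\vec w\setminus\emptyset=\vec w$. For $\mathbf s=(s_1,\ldots,s_k)$, $\mathbf t=(t_1,\ldots,t_l)$, $\mathbf s\odot\mathbf t=(s_1,\ldots,s_k,t_1,\ldots,t_l)$, and $\emptyset\odot\mathbf t=\mathbf t\odot\emptyset=\mathbf t$. $\vec u\prec\vec w$ ($\vec u$ is a variable reduction of $\vec w=(w_n)$), for $\vec u,\vec w\in W^\omega(\Sigma;\upsilon)$, means that there are $1=k_1<k_2<\cdots$ in $\mathbb N$ and $\alpha_j\in\Sigma\cup\{\upsilon\}$ ($j\in\mathbb N$), with $\upsilon\in\{\alpha_{k_n},\ldots,\alpha_{k_{n+1}-1}\}$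 for each $n$, such that the $n$-th term of $\vec u$ is $w_{k_n}(\alpha_{k_n})\ast\cdots\ast w_{k_{n+1}-1}(\alpha_{k_{n+1}-1})$. Ellentuck topology. For $\mathbf s\in W^{<\omega}(\Sigma;\upsilon)$, $\vec s\in W^\omega(\Sigma;\upsilon)$, $[\mathbf s,\vec s]=\{\vec w\in W^{\omega}(\Sigma;\upsilon):\mathbf s\propto\vec w\text{ and }\vec w\setminus\mathbf s\prec\vec s\}$ (so $[\emptyset,\vec s]=\{\vec w:\vec w\prec\vec s\}$). $\mathfrak T_E$ is the topology on $W^\omega(\Sigma;\upsilon)$ with these sets as basic open sets, and $\hat{\mathcal U}$ is the closure of $\mathcal U$ in $\mathfrak T_E$; equivalently $\hat{\mathcal U}=\{\vec w:[\mathbf s,\vec w\setminus\mathbf s]\cap\mathcal U\neq\emptyset\text{ for every }\mathbf s\propto\vec w\}$. Schreier system. For every non-zero countable limit ordinal $\lambda$ fix a strictly increasing sequence $(\lambda_n)_{n\in\mathbb N}$ of successor ordinals smaller than $\lambda$ with $\sup_n\lambda_n=\lambda$. For sets of naturals $s<t$ means every element of $s$ is smaller than every element of $t$. Families $\mathcal A_\xi$ ($\xi<\omega_1$): (1) $\mathcal A_0=\{\emptyset\}$, $\mathcal A_1=\{\{n\}:n\in\mathbb N\}$; (2) $\mathcal A_{\zeta+1}=\{\{n\}\cup s_1: n\in\mathbb N,\ \{n\}<s_1,\ s_1\in\mathcal A_\zeta\}$; (3i) $\mathcal A_{\omega^{\beta+1}}=\{\bigcup_{i=1}^n s_i: n=\min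 s_1,\ s_1<\cdots<s_n,\ s_1,\ldots,s_n\in\mathcal A_{\omega^\beta}\}$; (3ii) for a non-zero countable limit ordinal $\lambda$, $\mathcal A_{\omega^\lambda}=\{s\neq\emptyset: s\in\mathcal A_{\omega^{\lambda_n}}\text{ with }n=\min s\}$; (3iii) for a limit ordinal $\xi$ with $\omega^{\alpha}<\xi<\omega^{\alpha+1}$, $0<\alpha<\omega_1$, with Cantor normal form $\xi=\omega^\alpha p+\sum_{i=1}^m\omega^{a_i}p_i$ ($m\ge0$, $p,p_i\geq1$, $\alpha>a_1>\cdots>a_m>0$), $\mathcal A_\xi$ is the set of all $s=s_0\cup\bigcup_{i=1}^m s_i$ with $s_m<\cdots<s_1<s_0$, where $s_0$ is a union of $p$ sets $s^0_1<\cdots<s^0_p$ from $\mathcal A_{\omega^\alpha}$ and each $s_i$ is a union of $p_i$ sets $s^i_1<\cdots<s^i_{p_i}$ from $\mathcal A_{\omega^{a_i}}$. For a non-empty $\mathbf w=(w_1,\ldots,w_l)\in W^{<\omega}(\Sigma;\upsilon)$ put $k_1=1$, $k_{i+1}=k_i+\text{length}(w_i)$, and $d(\mathbf w)=\{k_2<\cdots<k_l\}$ ($=\emptyset$ if $l=1$). $W^0(\Sigma;\upsilon)$ is the set of one-term sequences of variable words; for countable $\xi\ge1$, $W^\xi(\Sigma;\upsilon)$ is the set of non-empty $\mathbf w\in W^{<\omega}(\Sigma;\upsilon)$ with $d(\mathbf w)\in\mathcal A_\xi$. *)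

theory Defs
  imports "HOL-Analysis.Analysis"
begin

section \<open>Countable ordinals\<close>

text \<open>
  \<open>natLeq\<close> is the well-order of the naturals and \<open>cardSuc natLeq\<close> is the successor cardinal
  of \<open>\<aleph>\<^sub>0\<close>, i.e. (a copy of) the initial ordinal \<open>\<omega>\<^sub>1\<close>. Its elements are the countable
  ordinals, \<open>0\<close> being the least one.
\<close>

lemma Card_order_omega1: "Card_order (cardSuc natLeq)"
  by (simp add: cardSuc_Card_order natLeq_Card_order)

lemma infinite_omega1: "infinite (Field (cardSuc natLeq))"
  using cardSuc_finite[OF natLeq_Card_order] by (simp add: Field_natLeq)

typedef cord = "Field (cardSuc natLeq)"
  using infinite_omega1 by (metis finite.emptyI ex_in_conv)

lemma wo_omega1: "wo_rel (cardSuc natLeq)"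
  using Card_order_omega1 by (simp add: card_order_on_well_order_on wo_rel_def)

instantiation cord :: linorder
begin

definition less_eq_cord :: "cord \<Rightarrow> cord \<Rightarrow> bool" where
  "\<alpha> \<le> \<beta> \<longleftrightarrow> (Rep_cord \<alpha>, Rep_cord \<beta>) \<in> cardSuc natLeq"

definition less_cord :: "cord \<Rightarrow> cord \<Rightarrow> bool" where
  "\<alpha> < \<beta> \<longleftrightarrow> \<alpha> \<le> \<beta> \<and> \<not> \<beta> \<le> (\<alpha>::cord)"

instance
proof
  fix x y z :: cord
  note R = Rep_cord[of x] Rep_cord[of y]
  show "x \<le> x"
    using wo_rel.REFL[OF wo_omega1] R unfolding less_eq_cord_def refl_on_def by auto
  show "x \<le> y \<Longrightarrow> y \<le> z \<Longrightarrow> x \<le> z"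
    using wo_rel.TRANS[OF wo_omega1] unfolding less_eq_cord_def trans_def by blast
  show "x \<le> y \<Longrightarrow> y \<le> x \<Longrightarrow> x = y"
    using wo_rel.ANTISYM[OF wo_omega1] unfolding less_eq_cord_def antisym_def
    by (metis Rep_cord_inject)
  show "x \<le> y \<or> y \<le> x"
    using wo_rel.TOTALS[OF wo_omega1] R unfolding less_eq_cord_def by blast
qed (simp add: less_cord_def)

end

lemma less_cord_iff:
  "\<alpha> < \<beta> \<longleftrightarrow> (Rep_cord \<alpha>, Rep_cord \<beta>) \<in> cardSuc natLeq - Id"
  using less_le[of \<alpha> \<beta>] by (auto simp: less_eq_cord_def Rep_cord_inject)

instance cord :: wellorder
proof
  fix P :: "cord \<Rightarrow> bool" and a
  assume step: "\<And>x. (\<And>y. y < x \<Longrightarrow> P y) \<Longrightarrow> P x"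
  have "wf (inv_image (cardSuc natLeq - Id) Rep_cord)"
    using wo_rel.WF[OF wo_omega1] by (rule wf_inv_image)
  then show "P a"
    by (induction a rule: wf_induct_rule) (use step in \<open>auto simp: less_cord_iff\<close>)
qed

lemma countable_iff_ordLeq_natLeq:
  includes cardinal_syntax
  shows "countable A \<longleftrightarrow> |A| \<le>o natLeq"
proof -
  have "countable A \<longleftrightarrow> |A| \<le>o |UNIV :: nat set|"
    unfolding countable_def card_of_ordLeq[symmetric] by auto
  then show ?thesis
    using card_of_nat ordLeq_ordIso_trans ordIso_symmetric by blast
qed

lemma countable_cord_lessThan:
  includes cardinal_syntax
  shows "countable {..<\<alpha>::cord}"
proof -
  have "|underS (cardSuc natLeq) (Rep_cord \<alpha>)| <o cardSuc natLeq"
    by (rule card_of_underS[OF Card_order_omega1 Rep_cord])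
  then have "|underS (cardSuc natLeq) (Rep_cord \<alpha>)| \<le>o natLeq"
    using cardSuc_ordLeq_ordLess natLeq_Card_order card_of_Card_order by blast
  then have "countable (underS (cardSuc natLeq) (Rep_cord \<alpha>))"
    by (simp add: countable_iff_ordLeq_natLeq)
  moreover have "Rep_cord ` {..<\<alpha>} \<subseteq> underS (cardSuc natLeq) (Rep_cord \<alpha>)"
    by (auto simp: underS_def less_cord_iff)
  ultimately have "countable (Rep_cord ` {..<\<alpha>})"
    using countable_subset by blast
  then show ?thesis
    using countable_image_inj_on Rep_cord_inject by (meson inj_onI)
qed

lemma uncountable_cord:
  includes cardinal_syntax
  shows "uncountable (UNIV :: cord set)"
proof
  assume "countable (UNIV :: cord set)"
  then have "countable (Field (cardSuc natLeq))"
    using type_definition.Rep_range[OF type_definition_cord] by (metis countable_image)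
  then have "|Field (cardSuc natLeq)| \<le>o natLeq"
    by (simp add: countable_iff_ordLeq_natLeq)
  then have "cardSuc natLeq \<le>o natLeq"
    using card_of_Field_ordIso[OF Card_order_omega1] ordIso_ordLeq_trans ordIso_symmetric by blast
  then show False
    using cardSuc_greater[OF natLeq_Card_order] not_ordLess_ordLeq by blast
qed

lemma countable_imp_ex_upper:
  assumes "countable (A :: cord set)"
  shows "\<exists>\<beta>. \<forall>\<alpha>\<in>A. \<alpha> < \<beta>"
proof (rule ccontr)
  assume "\<not> ?thesis"
  then have "(\<Union>\<alpha>\<in>A. insert \<alpha> {..<\<alpha>}) = UNIV"
    by (force simp: not_less le_less)
  moreover have "countable (\<Union>\<alpha>\<in>A. insert \<alpha> {..<\<alpha>})"
    using assms countable_cord_lessThan by auto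
  ultimately show False
    using uncountable_cord by simp
qed

instantiation cord :: conditionally_complete_linorder
begin

definition Inf_cord :: "cord set \<Rightarrow> cord" where
  "Inf (A :: cord set) = (LEAST \<alpha>. \<alpha> \<in> A)"

definition Sup_cord :: "cord set \<Rightarrow> cord" where
  "Sup (A :: cord set) = (LEAST \<beta>. \<forall>\<alpha>\<in>A. \<alpha> \<le> \<beta>)"

definition inf_cord :: "cord \<Rightarrow> cord \<Rightarrow> cord" where
  "inf_cord = min"

definition sup_cord :: "cord \<Rightarrow> cord \<Rightarrow> cord" where
  "sup_cord = max"

instance
proof
  fix x z :: cord and X :: "cord set"
  show "x \<in> X \<Longrightarrow> bdd_below X \<Longrightarrow> Inf X \<le> x"
    by (simp add: Inf_cord_def Least_le)
  show "X \<noteq> {} \<Longrightarrow> (\<And>x. x \<in> X \<Longrightarrow> z \<le> x) \<Longrightarrow> z \<le> Inf X"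
    unfolding Inf_cord_def using LeastI_ex[of "\<lambda>\<alpha>. \<alpha> \<in> X"] by blast
  show "x \<in> X \<Longrightarrow> bdd_above X \<Longrightarrow> x \<le> Sup X"
    unfolding Sup_cord_def bdd_above_def using LeastI_ex[of "\<lambda>\<beta>. \<forall>\<alpha>\<in>X. \<alpha> \<le> \<beta>"] by blast
  show "X \<noteq> {} \<Longrightarrow> (\<And>x. x \<in> X \<Longrightarrow> x \<le> z) \<Longrightarrow> Sup X \<le> z"
    unfolding Sup_cord_def by (rule Least_le) blast
qed (auto simp: inf_cord_def sup_cord_def)

end

lemma countable_imp_bdd_above: "countable (A :: cord set) \<Longrightarrow> bdd_above A"
  using countable_imp_ex_upper[of A] by (meson bdd_aboveI less_imp_le)

definition succ :: "cord \<Rightarrow> cord" where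
  "succ \<alpha> = (LEAST \<beta>. \<alpha> < \<beta>)"

definition is_succ :: "cord \<Rightarrow> bool" where
  "is_succ \<alpha> \<longleftrightarrow> (\<exists>\<beta>. \<alpha> = succ \<beta>)"

definition pred :: "cord \<Rightarrow> cord" where
  "pred \<alpha> = (THE \<beta>. \<alpha> = succ \<beta>)"

lemma less_succ: "\<alpha> < succ \<alpha>"
  using countable_imp_ex_upper[of "{\<alpha>}"] unfolding succ_def by (auto intro: LeastI_ex)

lemma succ_le_iff: "succ \<alpha> \<le> \<beta> \<longleftrightarrow> \<alpha> < \<beta>"
  using less_succ[of \<alpha>] by (auto simp: succ_def intro: Least_le)

lemma succ_inject: "succ \<alpha> = succ \<beta> \<longleftrightarrow> \<alpha> = \<beta>"
  by (metis less_succ succ_le_iff not_less_iff_gr_or_eq not_le)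

lemma pred_succ [simp]: "pred (succ \<alpha>) = \<alpha>"
  by (auto simp: pred_def succ_inject)

lemma is_succ_succ [simp]: "is_succ (succ \<alpha>)"
  by (auto simp: is_succ_def)

instantiation cord :: zero
begin
definition zero_cord :: cord where "0 = (LEAST \<alpha>::cord. True)"
instance ..
end

lemma zero_le_cord [simp]: "(0::cord) \<le> \<alpha>"
  by (simp add: zero_cord_def Least_le)

lemma succ_neq_0 [simp]: "succ \<alpha> \<noteq> 0"
  by (metis less_succ zero_le_cord not_le)

text \<open>Limit ordinals are non-zero by convention.\<close>

definition is_limit :: "cord \<Rightarrow> bool" where
  "is_limit \<alpha> \<longleftrightarrow> \<alpha> \<noteq> 0 \<and> \<not> is_succ \<alpha>"

text \<open>
  Transfinite recursion with supremum at limits: the continuous iterate of \<open>f\<close> starting at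
  \<open>z\<close>. The three clauses are stated in \<open>trec_clauses\<close>.
\<close>

function trec :: "cord \<Rightarrow> (cord \<Rightarrow> cord) \<Rightarrow> cord \<Rightarrow> cord" where
  "trec z f \<beta> =
    (if \<beta> = 0 then z
     else if is_succ \<beta> then f (trec z f (pred \<beta>))
     else (SUP \<delta>\<in>{..<\<beta>}. trec z f \<delta>))"
  by pat_completeness auto
termination
proof (relation "inv_image {(x, y). x < y} (\<lambda>(_, _, \<beta>). \<beta>)")
  show "wf (inv_image {(x, y :: cord). x < y} (\<lambda>(_ :: cord, _ :: cord \<Rightarrow> cord, \<beta>). \<beta>))"
    by (intro wf_inv_image wf)
qed (auto simp: is_succ_def less_succ)

declare trec.simps [simp del]

lemma trec_clauses:
  "trec z f 0 = z"
  "trec z f (succ \<beta>) = f (trec z f \<beta>)"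
  "is_limit \<beta> \<Longrightarrow> trec z f \<beta> = (SUP \<delta>\<in>{..<\<beta>}. trec z f \<delta>)"
  by (simp_all add: trec.simps[of z f "succ \<beta>"] trec.simps[of z f 0] is_limit_def)
     (simp add: trec.simps[of z f \<beta>])

instantiation cord :: "{one, plus, times}"
begin
definition one_cord :: cord where "1 = succ 0"
definition plus_cord :: "cord \<Rightarrow> cord \<Rightarrow> cord" where "\<alpha> + \<beta> = trec \<alpha> succ \<beta>"
definition times_cord :: "cord \<Rightarrow> cord \<Rightarrow> cord" where "\<alpha> * \<beta> = trec 0 (\<lambda>\<gamma>. \<gamma> + \<alpha>) \<beta>"
instance ..
end

definition fin_ord :: "nat \<Rightarrow> cord" where
  "fin_ord n = (succ ^^ n) 0"

definition omega :: cord where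
  "omega = (SUP n. fin_ord n)"

definition omega_pow :: "cord \<Rightarrow> cord" where
  "omega_pow \<beta> = trec 1 (\<lambda>\<gamma>. \<gamma> * omega) \<beta>"

text \<open>
  \<open>cnf_eval [(a\<^sub>1,p\<^sub>1),\<dots>,(a\<^sub>m,p\<^sub>m)]\<close> is \<open>\<omega>\<^bsup>a\<^sub>1\<^esup>\<cdot>p\<^sub>1 + \<dots> + \<omega>\<^bsup>a\<^sub>m\<^esup>\<cdot>p\<^sub>m\<close>.
\<close>

definition cnf_eval :: "(cord \<times> nat) list \<Rightarrow> cord" where
  "cnf_eval cs = foldr (\<lambda>(a, p) \<gamma>. omega_pow a * fin_ord p + \<gamma>) cs 0"

definition is_cnf :: "cord \<Rightarrow> (cord \<times> nat) list \<Rightarrow> bool" where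
  "is_cnf \<xi> cs \<longleftrightarrow>
    \<xi> = cnf_eval cs \<and> sorted_wrt (>) (map fst cs) \<and> (\<forall>(a, p)\<in>set cs. 1 \<le> p)"


section \<open>The Schreier system\<close>

text \<open>
  A choice, for every countable limit ordinal \<open>\<eta>\<close>, of a sequence \<open>\<eta>\<^sub>n = L \<eta> n\<close> of successor
  ordinals increasing to \<open>\<eta>\<close>. The index \<open>n\<close> ranges over the positive naturals; \<open>L \<eta> 0\<close> is
  irrelevant.
\<close>

definition fundamental_system :: "(cord \<Rightarrow> nat \<Rightarrow> cord) \<Rightarrow> bool" where
  "fundamental_system L \<longleftrightarrow>
    (\<forall>\<eta>. is_limit \<eta> \<longrightarrow>
      strict_mono_on {1..} (L \<eta>) \<and>
      (\<forall>n\<ge>1. is_succ (L \<eta> n) \<and> L \<eta> n < \<eta>) \<and>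
      (SUP n\<in>{1..}. L \<eta> n) = \<eta>)"

definition set_less :: "nat set \<Rightarrow> nat set \<Rightarrow> bool" where
  "set_less s t \<longleftrightarrow> (\<forall>x\<in>s. \<forall>y\<in>t. x < y)"

text \<open>\<open>s\<close> is a union of \<open>n\<close> sets \<open>s\<^sub>1 < \<dots> < s\<^sub>n\<close> satisfying \<open>P\<close>.\<close>

definition chain_union :: "(nat set \<Rightarrow> bool) \<Rightarrow> nat \<Rightarrow> nat set \<Rightarrow> bool" where
  "chain_union P n s \<longleftrightarrow>
    (\<exists>xs. length xs = n \<and> (\<forall>x\<in>set xs. P x) \<and> sorted_wrt set_less xs \<and> s = \<Union>(set xs))"

lemma chain_union_mono [mono]:
  "(\<And>x. P x \<longrightarrow> Q x) \<Longrightarrow> chain_union P n s \<longrightarrow> chain_union Q n s"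
  unfolding chain_union_def by blast

text \<open>
  For \<open>cs = [(a\<^sub>0,p\<^sub>0),\<dots>,(a\<^sub>m,p\<^sub>m)]\<close>: \<open>s = s\<^sub>0 \<union> \<dots> \<union> s\<^sub>m\<close> with \<open>s\<^sub>m < \<dots> < s\<^sub>0\<close>, each \<open>s\<^sub>i\<close> being a union
  of a chain of \<open>p\<^sub>i\<close> sets satisfying \<open>P a\<^sub>i\<close>. The list \<open>ss\<close> is \<open>[s\<^sub>0,\<dots>,s\<^sub>m]\<close>, hence descending.
\<close>

definition cnf_union ::
  "(cord \<Rightarrow> nat set \<Rightarrow> bool) \<Rightarrow> (cord \<times> nat) list \<Rightarrow> nat set \<Rightarrow> bool" where
  "cnf_union P cs s \<longleftrightarrow>
    (\<exists>ss. list_all2 (\<lambda>(a, p). chain_union (P a) p) cs ss \<and>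
      sorted_wrt (\<lambda>s t. set_less t s) ss \<and> s = \<Union>(set ss))"

lemma cnf_union_mono [mono]:
  assumes "\<And>a x. P a x \<longrightarrow> Q a x"
  shows "cnf_union P cs s \<longrightarrow> cnf_union Q cs s"
proof
  assume "cnf_union P cs s"
  then obtain ss where "list_all2 (\<lambda>(a, p). chain_union (P a) p) cs ss"
    and ss: "sorted_wrt (\<lambda>s t. set_less t s) ss" "s = \<Union>(set ss)"
    unfolding cnf_union_def by blast
  moreover have "chain_union (P a) p x \<Longrightarrow> chain_union (Q a) p x" for a p x
    using chain_union_mono[of "P a" "Q a" p x] assms by blast
  ultimately have "list_all2 (\<lambda>(a, p). chain_union (Q a) p) cs ss"
    by (elim list_all2_mono) auto
  with ss show "cnf_union Q cs s"
    unfolding cnf_union_def by blast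
qed

text \<open>
  \<open>schreier L \<xi> s\<close> means \<open>s \<in> \<A>\<^sub>\<xi>\<close>. Every countable ordinal is covered by exactly one clause
  (except \<open>\<xi> = 1\<close>, where \<open>one\<close> and \<open>succ\<close> agree), and each clause only refers to smaller
  ordinals, so the least fixed point is the family defined by recursion on \<open>\<xi>\<close>.
\<close>

inductive schreier :: "(cord \<Rightarrow> nat \<Rightarrow> cord) \<Rightarrow> cord \<Rightarrow> nat set \<Rightarrow> bool"
  for L :: "cord \<Rightarrow> nat \<Rightarrow> cord" where
  zero: "schreier L 0 {}"
| one: "n \<ge> 1 \<Longrightarrow> schreier L 1 {n}"
| succ: "schreier L (succ \<zeta>) ({n} \<union> s)"
    if "n \<ge> 1" "set_less {n} s" "schreier L \<zeta> s"
| omega_pow_succ: "schreier L (omega_pow (succ \<beta>)) (\<Union>(set ss))"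
    if "ss \<noteq> []" "length ss = Min (hd ss)"
       "\<forall>s\<in>set ss. schreier L (omega_pow \<beta>) s" "sorted_wrt set_less ss"
| omega_pow_limit: "schreier L (omega_pow \<eta>) s"
    if "is_limit \<eta>" "s \<noteq> {}" "schreier L (omega_pow (L \<eta> (Min s))) s"
| cnf: "schreier L \<xi> s"
    if "is_limit \<xi>" "0 < \<alpha>" "omega_pow \<alpha> < \<xi>" "\<xi> < omega_pow (succ \<alpha>)"
       "is_cnf \<xi> ((\<alpha>, p) # cs)" "\<forall>(a, q)\<in>set cs. 0 < a"
       "cnf_union (\<lambda>a. schreier L (omega_pow a)) ((\<alpha>, p) # cs) s"


section \<open>Variable words\<close>

text \<open>
  \<open>S\<close> is the alphabet and \<open>v\<close> the variable. Infinite sequences are indexed from \<open>0\<close>, so the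
  \<open>n\<close>-th term is \<open>w (n - 1)\<close>.
\<close>

definition var_words :: "'a set \<Rightarrow> 'a \<Rightarrow> 'a list set" where
  "var_words S v = {w. w \<noteq> [] \<and> set w \<subseteq> insert v S \<and> v \<in> set w}"

definition subst :: "'a \<Rightarrow> 'a \<Rightarrow> 'a list \<Rightarrow> 'a list" where
  "subst v \<alpha> w = map (\<lambda>x. if x = v then \<alpha> else x) w"

definition fin_seqs :: "'a set \<Rightarrow> 'a \<Rightarrow> 'a list list set" where
  "fin_seqs S v = lists (var_words S v)"

definition inf_seqs :: "'a set \<Rightarrow> 'a \<Rightarrow> (nat \<Rightarrow> 'a list) set" where
  "inf_seqs S v = {w. \<forall>n. w n \<in> var_words S v}"

definition initial_segment :: "'b list \<Rightarrow> (nat \<Rightarrow> 'b) \<Rightarrow> bool" where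
  "initial_segment s w \<longleftrightarrow> (\<forall>i<length s. s ! i = w i)"

text \<open>The sequence \<open>w \ s\<close>, meaningful when \<open>initial_segment s w\<close>.\<close>

definition seq_minus :: "(nat \<Rightarrow> 'b) \<Rightarrow> 'b list \<Rightarrow> (nat \<Rightarrow> 'b)" where
  "seq_minus w s = (\<lambda>n. w (length s + n))"

definition reduction :: "'a set \<Rightarrow> 'a \<Rightarrow> (nat \<Rightarrow> 'a list) \<Rightarrow> (nat \<Rightarrow> 'a list) \<Rightarrow> bool" where
  "reduction S v u w \<longleftrightarrow>
    u \<in> inf_seqs S v \<and> w \<in> inf_seqs S v \<and>
    (\<exists>k \<alpha>. k 0 = 0 \<and> strict_mono k \<and>
      (\<forall>j. \<alpha> j \<in> insert v S) \<and>
      (\<forall>n. v \<in> \<alpha> ` {k n..<k (Suc n)}) \<and>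
      (\<forall>n. u n = concat (map (\<lambda>j. subst v (\<alpha> j) (w j)) [k n..<k (Suc n)])))"

definition basic_set ::
  "'a set \<Rightarrow> 'a \<Rightarrow> 'a list list \<Rightarrow> (nat \<Rightarrow> 'a list) \<Rightarrow> (nat \<Rightarrow> 'a list) set" where
  "basic_set S v s x =
    {w \<in> inf_seqs S v. initial_segment s w \<and> reduction S v (seq_minus w s) x}"

definition ellentuck :: "'a set \<Rightarrow> 'a \<Rightarrow> (nat \<Rightarrow> 'a list) topology" where
  "ellentuck S v =
    topology_generated_by {basic_set S v s x | s x. s \<in> fin_seqs S v \<and> x \<in> inf_seqs S v}"

text \<open>
  \<open>start_positions w\<close> is \<open>d(w)\<close>: the (1-based) positions in the concatenation of \<open>w\<close> at which
  the second, third, \dots, last word begins.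
\<close>

definition start_positions :: "'a list list \<Rightarrow> nat set" where
  "start_positions w = {1 + sum_list (map length (take i w)) | i. 1 \<le> i \<and> i < length w}"

definition schreier_seqs ::
  "(cord \<Rightarrow> nat \<Rightarrow> cord) \<Rightarrow> 'a set \<Rightarrow> 'a \<Rightarrow> cord \<Rightarrow> 'a list list set" where
  "schreier_seqs L S v \<xi> =
    (if \<xi> = 0 then {w \<in> fin_seqs S v. length w = 1}
     else {w \<in> fin_seqs S v. w \<noteq> [] \<and> schreier L \<xi> (start_positions w)})"

end

(*
  Call a finite sequence t bad if U meets [s * t, y] for every y taken from the current
  sequence. A fusion argument makes badness independent of y, so that the bad sequences form a tree T,
  and the Nash-Williams dichotomy for T yields a reduction of x on which either every finite sequence
  is bad, which puts [s, u] into the closure of U, or T is well-founded. In the second case T is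
  countable and has a countable rank rho. Applied to the sequences of W^xi that lie in T, the
  Nash-Williams dichotomy gives either the desired u or a u all of whose reductions leave T only after
  an initial segment in W^xi; the latter forces the rank of T to be at least that of the family A_xi,
  which exceeds rho as soon as xi > omega^rho. Only this crude lower bound for the rank is
  needed, so neither thinness of A_xi nor existence of Cantor normal forms plays a role.

  The pigeonhole principle behind the Nash-Williams dichotomy is Carlson's theorem: for a minimal
  idempotent ultrafilter p on constant words there is an idempotent q on variable words
  with q = pq = qp, and every substitution of a letter maps q to p.
*)
theory Submission
  imports Defs "HOL-Library.Omega_Words_Fun"
begin

section \<open>Idempotents in compact right topological semigroups\<close>

text \<open>The link between sequences of words and sets of naturals is the position at which the
  next word starts. Joining enough consecutive words of the current sequence, with the variable
  kept, pushes this position beyond any bound. A rank estimate that holds only along large integers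
  can therefore be followed inside T, which is why \<open>long\<close> quantifies over all n above
  some n0. The power omega^rho comes from a weak but stable estimate: deleting the least element n
  >= 2 of a member of A_(omega^(beta+1)) leaves a set that ends in a member of A_(omega^beta), so
  each step of the exponent adds at least one level. Two ultrafilters are needed in the pigeonhole
  step because letters and the variable are mixed within one product: substituting a letter yields
  p-typical constant words, keeping the variable yields q-typical words, and the equations between p
  and q say that a product with at least one factor of the second kind is again q-typical.\<close>

lemma compact_UNIV_bool_fun: "compact (UNIV :: ('i \<Rightarrow> bool) set)"
proof -
  have "compact_space (product_topology (\<lambda>i::'i. euclidean :: bool topology) UNIV)"
    unfolding compact_space_product_topology by (simp add: compact_space_def finite_imp_compact)
  then show ?thesis
    by (simp add: euclidean_product_topology compact_space_def)
qed

lemma compact_imp_closed_bool_fun: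
  fixes C :: "('i \<Rightarrow> bool) set"
  assumes "compact C"
  shows "closed C"
proof -
  have "Hausdorff_space (euclidean :: bool topology)"
    unfolding Hausdorff_space_def
  proof (intro allI impI)
    fix a b :: bool assume "a \<in> topspace euclidean \<and> b \<in> topspace euclidean \<and> a \<noteq> b"
    then show "\<exists>U V. openin euclidean U \<and> openin euclidean V \<and> a \<in> U \<and> b \<in> V \<and> disjnt U V"
      by (intro exI[of _ "{a}"] exI[of _ "{b}"]) (simp add: open_discrete)
  qed
  then have "Hausdorff_space (euclidean :: ('i \<Rightarrow> bool) topology)"
    unfolding euclidean_product_topology[symmetric]
    by (simp add: Hausdorff_space_product_topology)
  then show ?thesis
    using compactin_imp_closedin[of euclidean C] assms by simp
qed

lemma closed_coordinate: "closed {p :: 'i \<Rightarrow> bool. p A = b}"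
  by (intro closed_Collect_eq) (auto intro: continuous_on_const)

text \<open>Zorn's lemma for descending chains: it is applied to complements, and compactness keeps
  the intersection of a chain of non-empty closed sets non-empty. The parameter \<open>P\<close>
  covers both uses, subsemigroups and left ideals.\<close>

lemma ex_minimal_closed:
  fixes C :: "('i \<Rightarrow> bool) set"
  assumes "closed C" "C \<noteq> {}" "P C"
    and inter: "\<And>\<C>. \<C> \<noteq> {} \<Longrightarrow> \<forall>D\<in>\<C>. P D \<Longrightarrow> P (\<Inter>\<C>)"
  obtains D where "D \<subseteq> C" "closed D" "D \<noteq> {}" "P D"
    "\<And>E. E \<subseteq> D \<Longrightarrow> closed E \<Longrightarrow> E \<noteq> {} \<Longrightarrow> P E \<Longrightarrow> E = D"
proof -
  define Q where "Q = {D. D \<subseteq> C \<and> closed D \<and> D \<noteq> {} \<and> P D}"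
  have "\<exists>M\<in>uminus ` Q. \<forall>X\<in>uminus ` Q. M \<subseteq> X \<longrightarrow> X = M"
  proof (rule subset_Zorn_nonempty)
    show "uminus ` Q \<noteq> {}"
      using assms by (auto simp: Q_def)
  next
    fix \<C> assume ne: "\<C> \<noteq> {}" and ch: "subset.chain (uminus ` Q) \<C>"
    define \<D> where "\<D> = uminus ` \<C>"
    have chD: "subset.chain Q \<D>"
      unfolding subset_chain_def
    proof (intro conjI ballI)
      show "\<D> \<subseteq> Q"
        using ch by (auto simp: \<D>_def subset_chain_def)
      fix X Y assume "X \<in> \<D>" "Y \<in> \<D>"
      then have "- X \<in> \<C>" "- Y \<in> \<C>"
        by (auto simp: \<D>_def)
      moreover have "\<forall>X\<in>\<C>. \<forall>Y\<in>\<C>. X \<subseteq> Y \<or> Y \<subseteq> X"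
        using ch by (simp add: subset_chain_def)
      ultimately show "X \<subseteq> Y \<or> Y \<subseteq> X"
        by (metis Compl_subset_Compl_iff)
    qed
    have neD: "\<D> \<noteq> {}"
      using ne by (simp add: \<D>_def)
    have sub: "\<D> \<subseteq> Q"
      using chD by (simp add: subset_chain_def)
    have "UNIV \<inter> \<Inter>\<D> \<noteq> {}"
    proof (rule compact_imp_fip[OF compact_UNIV_bool_fun])
      show "closed T" if "T \<in> \<D>" for T
        using that sub by (auto simp: Q_def)
      fix F assume F: "finite F" "F \<subseteq> \<D>"
      show "UNIV \<inter> \<Inter>F \<noteq> {}"
      proof (cases "F = {}")
        case False
        have "subset.chain Q F"
          using chD F(2) by (meson subset_chain_def subset_trans subsetD)
        then have "\<Inter>F \<in> F"
          using Inter_in_chain F(1) False by blast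
        then show ?thesis
          using F(2) sub by (auto simp: Q_def)
      qed simp
    qed
    then have "\<Inter>\<D> \<in> Q"
      using neD sub inter[OF neD] unfolding Q_def by auto
    moreover have "\<Union>\<C> = - \<Inter>\<D>"
      by (auto simp: \<D>_def)
    ultimately show "\<Union>\<C> \<in> uminus ` Q"
      by blast
  qed
  then obtain M where M: "M \<in> uminus ` Q" "\<And>X. X \<in> Q \<Longrightarrow> M \<subseteq> - X \<Longrightarrow> - X = M"
    by (metis imageI)
  from M(1) obtain D where D: "D \<in> Q" "M = - D"
    by (rule imageE)
  show thesis
  proof (rule that[of D])
    fix E assume "E \<subseteq> D" "closed E" "E \<noteq> {}" "P E"
    then have "E \<in> Q"
      using D(1) subset_trans[of E D C] by (simp add: Q_def)
    then show "E = D"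
      using M(2)[of E] \<open>E \<subseteq> D\<close> D(2) by (simp add: Compl_anti_mono)
  qed (use D(1) in \<open>auto simp: Q_def\<close>)
qed

text \<open>Points are characteristic functions, so ultrafilters become points of a compact product
  of two-point spaces. Continuity is asked in the left factor only, which is what convolution of
  ultrafilters offers; \<open>assoc\<close> and \<open>cont\<close> range over all functions because
  convolution satisfies them there outright.\<close>

locale right_topological_semigroup =
  fixes K :: "('i \<Rightarrow> bool) set" and m :: "('i \<Rightarrow> bool) \<Rightarrow> ('i \<Rightarrow> bool) \<Rightarrow> 'i \<Rightarrow> bool"
  assumes closed_carrier: "closed K" and nonempty: "K \<noteq> {}"
    and mult_closed: "\<And>p q. p \<in> K \<Longrightarrow> q \<in> K \<Longrightarrow> m p q \<in> K"
    and assoc: "\<And>p q r. m (m p q) r = m p (m q r)"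
    and cont: "\<And>q. continuous_on UNIV (\<lambda>p. m p q)"
begin

lemma closed_image: "closed C \<Longrightarrow> closed ((\<lambda>p. m p q) ` C)"
  using compact_Int_closed[OF compact_UNIV_bool_fun, of C]
  by (intro compact_imp_closed_bool_fun compact_continuous_image continuous_on_subset[OF cont]) auto

lemma closed_fibre: "closed {p. m p q = r}"
proof -
  have "{p. m p q = r} = (\<Inter>A. (\<lambda>p. m p q) -` {s. s A = r A})"
    by (auto simp: fun_eq_iff)
  moreover have "closed ((\<lambda>p. m p q) -` {s. s A = r A})" for A
    by (intro closed_vimage closed_coordinate cont)
  ultimately show ?thesis
    by auto
qed

text \<open>The Ellis-Numakura argument. For \<open>e\<close> in a minimal closed subsemigroup
  \<open>D\<close>, the translate De is a closed subsemigroup of \<open>D\<close>, hence equals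
  \<open>D\<close>; this makes the stabiliser of \<open>e\<close> in \<open>D\<close> non-empty, and
  as another closed subsemigroup it is all of \<open>D\<close> and contains
  \<open>e\<close>.\<close>

lemma ex_idempotent:
  assumes "closed C" "C \<noteq> {}" "C \<subseteq> K" and semi: "\<forall>p\<in>C. \<forall>q\<in>C. m p q \<in> C"
  obtains e where "e \<in> C" "m e e = e"
proof -
  obtain D where D: "D \<subseteq> C" "closed D" "D \<noteq> {}" "\<forall>p\<in>D. \<forall>q\<in>D. m p q \<in> D"
    and min: "\<And>E. E \<subseteq> D \<Longrightarrow> closed E \<Longrightarrow> E \<noteq> {} \<Longrightarrow> \<forall>p\<in>E. \<forall>q\<in>E. m p q \<in> E \<Longrightarrow> E = D"
    by (rule ex_minimal_closed[where P = "\<lambda>D. \<forall>p\<in>D. \<forall>q\<in>D. m p q \<in> D", OF assms(1,2,4)]) blast+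
  obtain e where e: "e \<in> D"
    using D(3) by blast
  have "(\<lambda>p. m p e) ` D = D"
  proof (rule min)
    have "m (m p e) (m q e) \<in> (\<lambda>p. m p e) ` D" if "p \<in> D" "q \<in> D" for p q
      using that D(4) e by (intro image_eqI[of _ _ "m (m p e) q"]) (auto simp: assoc)
    then show "\<forall>p\<in>(\<lambda>p. m p e) ` D. \<forall>q\<in>(\<lambda>p. m p e) ` D. m p q \<in> (\<lambda>p. m p e) ` D"
      by blast
  qed (use D e closed_image in auto)
  then obtain p where "p \<in> D" "m p e = e"
    using e by (metis imageE)
  have "D \<inter> {p. m p e = e} = D"
  proof (rule min)
    show "closed (D \<inter> {p. m p e = e})"
      using D(2) closed_fibre by (rule closed_Int)
  qed (use D(4) \<open>p \<in> D\<close> \<open>m p e = e\<close> in \<open>auto simp: assoc\<close>)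
  then have "m e e = e"
    using e by blast
  then show thesis
    using that e D(1) by blast
qed

text \<open>Minimality refers to the order r <= p iff rp = pr = r. An idempotent p of a minimal
  closed left ideal \<open>I\<close> works: r = rp lies in \<open>I\<close>, so Kr is a closed left
  ideal inside \<open>I\<close> and contains p; writing p = xr gives pr = p.\<close>

lemma ex_minimal_idempotent:
  obtains p where "p \<in> K" "m p p = p"
    "\<And>r. r \<in> K \<Longrightarrow> m r r = r \<Longrightarrow> m r p = r \<Longrightarrow> m p r = r \<Longrightarrow> r = p"
proof -
  obtain I where I: "I \<subseteq> K" "closed I" "I \<noteq> {}" "\<forall>p\<in>K. \<forall>q\<in>I. m p q \<in> I"
    and min: "\<And>E. E \<subseteq> I \<Longrightarrow> closed E \<Longrightarrow> E \<noteq> {} \<Longrightarrow> \<forall>p\<in>K. \<forall>q\<in>E. m p q \<in> E \<Longrightarrow> E = I"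
    by (rule ex_minimal_closed[where P = "\<lambda>D. \<forall>p\<in>K. \<forall>q\<in>D. m p q \<in> D", OF closed_carrier nonempty])
      (use mult_closed in blast)+
  obtain p where p: "p \<in> I" "m p p = p"
    using ex_idempotent[OF I(2,3,1)] I(1,4) by blast
  show thesis
  proof (rule that[of p])
    fix r assume r: "r \<in> K" "m r r = r" "m r p = r" "m p r = r"
    have rI: "r \<in> I"
      using r p I(4) by metis
    have "(\<lambda>q. m q r) ` K = I"
    proof (rule min)
      show "\<forall>p\<in>K. \<forall>q\<in>(\<lambda>q. m q r) ` K. m p q \<in> (\<lambda>q. m q r) ` K"
        by (auto simp: assoc[symmetric] mult_closed)
    qed (use I(4) rI nonempty closed_image[OF closed_carrier] in auto)
    then obtain x where "x \<in> K" "p = m x r"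
      using p by blast
    then have "m p r = p"
      by (simp add: assoc r(2))
    then show "r = p"
      by (simp add: r(4))
  qed (use p I in auto)
qed

end

section \<open>Carlson's theorem\<close>

definition ultra :: "('b set \<Rightarrow> bool) \<Rightarrow> bool" where
  "ultra p \<longleftrightarrow> (\<forall>A B. p (A \<inter> B) \<longleftrightarrow> p A \<and> p B) \<and> (\<forall>A. p (- A) \<longleftrightarrow> \<not> p A)"

lemma ultra_Int: "ultra p \<Longrightarrow> p (A \<inter> B) \<longleftrightarrow> p A \<and> p B"
  by (simp add: ultra_def)

lemma ultra_Compl: "ultra p \<Longrightarrow> p (- A) \<longleftrightarrow> \<not> p A"
  by (simp add: ultra_def)

lemma ultra_mono: "ultra p \<Longrightarrow> p A \<Longrightarrow> A \<subseteq> B \<Longrightarrow> p B"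
  by (metis ultra_Int inf.absorb_iff1)

text \<open>One of a set and its complement is large, and large sets are closed upwards because the
  clause for intersections is an equivalence. The axioms of a proper filter are thus consequences of
  the two clauses of \<open>ultra\<close>.\<close>

lemma ultra_UNIV: "ultra p \<Longrightarrow> p UNIV"
  by (metis ultra_Compl ultra_mono subset_UNIV)

lemma ultra_nonempty: "ultra p \<Longrightarrow> p A \<Longrightarrow> \<exists>x. x \<in> A"
  using ultra_Compl[of p "{}"] ultra_UNIV[of p] by (cases "A = {}") auto

lemma ultra_cong: "ultra p \<Longrightarrow> p B \<Longrightarrow> A \<inter> B = A' \<inter> B \<Longrightarrow> p A = p A'"
  by (metis ultra_Int)

lemma ultra_INT: "finite I \<Longrightarrow> ultra p \<Longrightarrow> (\<And>i. i \<in> I \<Longrightarrow> p (A i)) \<Longrightarrow> p (\<Inter>i\<in>I. A i)"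
  by (induction I rule: finite_induct) (auto simp: ultra_UNIV ultra_Int)

lemma ultra_principal: "ultra (\<lambda>A. x \<in> A)"
  by (simp add: ultra_def)

text \<open>Both axioms are rewritten as positive Boolean combinations of equations between one
  coordinate and a constant, from which closedness can be read off.\<close>

lemma closed_ultra: "closed {p :: 'b set \<Rightarrow> bool. ultra p}"
proof -
  have "ultra p \<longleftrightarrow> (\<forall>A B. (p (A \<inter> B) = False \<or> p A = True) \<and> (p (A \<inter> B) = False \<or> p B = True) \<and>
      (p (A \<inter> B) = True \<or> p A = False \<or> p B = False)) \<and>
      (\<forall>A. (p (- A) = True \<or> p A = True) \<and> (p (- A) = False \<or> p A = False))" for p :: "'b set \<Rightarrow> bool"
    unfolding ultra_def by (rule conj_cong, (rule iff_allI)+, blast, rule iff_allI, blast)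
  then show ?thesis
    by (simp only:) (intro closed_Collect_conj closed_Collect_disj closed_Collect_all closed_coordinate)
qed

lemma closed_ultra_on: "closed {p :: 'b set \<Rightarrow> bool. ultra p \<and> p A}"
  using closed_Collect_conj[OF closed_ultra closed_coordinate[of A True]] by simp

text \<open>Extension of concatenation to the Stone-Cech compactification of the free monoid.
  Coordinate \<open>A\<close> of the product is a single coordinate of \<open>p\<close>, whence
  continuity in the left factor.\<close>

definition conv :: "('c list set \<Rightarrow> bool) \<Rightarrow> ('c list set \<Rightarrow> bool) \<Rightarrow> 'c list set \<Rightarrow> bool" where
  "conv p q = (\<lambda>A. p {x. q {y. x @ y \<in> A}})"

lemma ultra_conv:
  assumes "ultra p" "ultra q"
  shows "ultra (conv p q)"
  using assms
  by (simp add: ultra_def conv_def Collect_conj_eq Collect_neg_eq)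

lemma conv_assoc: "conv (conv p q) r = conv p (conv q r)"
  by (simp add: conv_def)

lemma conv_memI:
  assumes "ultra p" "ultra q" "p A" "q B" "\<And>x y. x \<in> A \<Longrightarrow> y \<in> B \<Longrightarrow> x @ y \<in> C"
  shows "conv p q C"
  unfolding conv_def
  by (rule ultra_mono[OF assms(1,3)]) (auto intro: ultra_mono[OF assms(2,4)] assms(5))

lemma continuous_conv: "continuous_on UNIV (\<lambda>p. conv p q)"
  unfolding conv_def by (intro continuous_on_coordinatewise_then_product) simp

definition push :: "('b \<Rightarrow> 'c) \<Rightarrow> ('b set \<Rightarrow> bool) \<Rightarrow> 'c set \<Rightarrow> bool" where
  "push h p = (\<lambda>A. p {x. h x \<in> A})"

lemma ultra_push: "ultra p \<Longrightarrow> ultra (push h p)"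
  by (simp add: ultra_def push_def Collect_conj_eq Collect_neg_eq)

lemma push_conv:
  assumes "\<And>x y. h (x @ y) = h x @ h y"
  shows "push h (conv p q) = conv (push h p) (push h q)"
  by (simp add: push_def conv_def assms)

section \<open>Idempotents compatible with substitution\<close>

lemma subst_append: "subst v a (x @ y) = subst v a x @ subst v a y"
  by (simp add: subst_def)

lemma subst_lists: "v \<notin> S \<Longrightarrow> x \<in> lists S \<Longrightarrow> subst v a x = x"
  by (auto simp: subst_def intro!: map_idI)

lemma subst_in_lists: "a \<in> S \<Longrightarrow> x \<in> var_words S v \<Longrightarrow> subst v a x \<in> lists S"
  by (auto simp: subst_def var_words_def)

lemma subst_self [simp]: "subst v v x = x"
  by (auto simp: subst_def intro!: map_idI)

lemma ex_carlson_ultrafilters: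
  assumes "v \<notin> S"
  obtains p q where "ultra p" "p (lists S)" "ultra q" "q (var_words S v)"
    "conv p p = p" "conv q q = q" "conv p q = q" "conv q p = q"
    "\<And>a. a \<in> S \<Longrightarrow> push (subst v a) q = p"
proof -
  define BS where "BS = {p. ultra p \<and> p (lists S)}"
  define BV where "BV = {p. ultra p \<and> p (var_words S v)}"
  interpret const: right_topological_semigroup BS conv
  proof
    show "BS \<noteq> {}"
      using ultra_principal[of "[]"] by (auto simp: BS_def intro!: exI[of _ "\<lambda>A. [] \<in> A"])
    show "conv p q \<in> BS" if "p \<in> BS" "q \<in> BS" for p q
      using that by (auto simp: BS_def ultra_conv intro!: conv_memI[of p q "lists S" "lists S"])
  qed (auto simp: BS_def closed_ultra_on conv_assoc continuous_conv)
  \<comment> \<open>\<open>J\<close> below consists of ultrafilters on variable words and so lies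
    outside \<open>BS\<close>; its idempotent is found in the semigroup of all ultrafilters.\<close>
  interpret all: right_topological_semigroup "{p :: 'a list set \<Rightarrow> bool. ultra p}" conv
  proof
    show "{p :: 'a list set \<Rightarrow> bool. ultra p} \<noteq> {}"
      using ultra_principal[of "[]"] by (auto intro!: exI[of _ "\<lambda>A. [] \<in> A"])
  qed (auto simp: closed_ultra conv_assoc continuous_conv ultra_conv)
  have closedV: "closed BV"
    unfolding BV_def by (rule closed_ultra_on)
  have neV: "BV \<noteq> {}"
    using ultra_principal[of "[v]"]
    by (auto simp: BV_def var_words_def intro!: exI[of _ "\<lambda>A. [v] \<in> A"])
  have leftV: "conv r q \<in> BV" if "r \<in> BS" "q \<in> BV" for r q
    using that by (auto simp: BS_def BV_def ultra_conv intro!: conv_memI[of r q "lists S" "var_words S v"])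
      (auto simp: var_words_def)
  have rightV: "conv q r \<in> BV" if "q \<in> BV" "r \<in> BS" for r q
    using that by (auto simp: BS_def BV_def ultra_conv intro!: conv_memI[of q r "var_words S v" "lists S"])
      (auto simp: var_words_def)
  have VV: "conv q r \<in> BV" if "q \<in> BV" "r \<in> BV" for r q
    using that by (auto simp: BV_def ultra_conv intro!: conv_memI[of q r "var_words S v" "var_words S v"])
      (auto simp: var_words_def)
  obtain p where p: "p \<in> BS" "conv p p = p"
    and min: "\<And>r. r \<in> BS \<Longrightarrow> conv r r = r \<Longrightarrow> conv r p = r \<Longrightarrow> conv p r = r \<Longrightarrow> r = p"
    using const.ex_minimal_idempotent by metis
  \<comment> \<open>Right multiplication by \<open>p\<close> makes every element e of
    \<open>J\<close> satisfy ep = e. \<open>J\<close> is a semigroup because (rp)(sp) = (r(ps))p and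
    variable words absorb constant words.\<close>
  define J where "J = (\<lambda>r. conv r p) ` BV"
  obtain e where e: "e \<in> J" "conv e e = e"
  proof (rule all.ex_idempotent[of J])
    show "closed J"
      unfolding J_def by (rule all.closed_image[OF closedV])
    show "\<forall>p\<in>J. \<forall>q\<in>J. conv p q \<in> J"
    proof (intro ballI)
      fix x y assume "x \<in> J" "y \<in> J"
      then obtain r s where rs: "r \<in> BV" "x = conv r p" "s \<in> BV" "y = conv s p"
        by (auto simp: J_def)
      then have "conv x y = conv (conv r (conv p s)) p"
        by (simp add: conv_assoc)
      then show "conv x y \<in> J"
        unfolding J_def using rs VV leftV p(1) by blast
    qed
    show "J \<subseteq> {p. ultra p}"
      using rightV p(1) by (auto simp: J_def BV_def)
  qed (use neV in \<open>auto simp: J_def\<close>)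
  obtain r where r: "r \<in> BV" "e = conv r p"
    using e(1) by (auto simp: J_def)
  have ep: "conv e p = e"
    by (simp add: r(2) conv_assoc p(2))
  \<comment> \<open>Left multiplication by \<open>p\<close> adds pq = q and keeps qp = q;
    idempotency survives since (pe)(pe) = p(ep)e = pe.\<close>
  define q where "q = conv p e"
  have qp: "conv q p = q"
    by (simp add: q_def conv_assoc ep)
  have pq: "conv p q = q"
    by (simp add: q_def conv_assoc[symmetric] p(2))
  have qq: "conv q q = q"
    by (metis q_def conv_assoc ep e(2))
  have qV: "q \<in> BV"
    using leftV rightV p(1) r by (simp add: q_def)
  \<comment> \<open>Substitution is a homomorphism that fixes \<open>p\<close>, so it maps
    \<open>q\<close> to an idempotent below \<open>p\<close> on constant words, and minimality of
    \<open>p\<close> forces equality.\<close>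
  have "push (subst v a) q = p" if a: "a \<in> S" for a
  proof (rule min)
    have hom: "push (subst v a) (conv x y) = conv (push (subst v a) x) (push (subst v a) y)" for x y
      by (rule push_conv) (rule subst_append)
    have "push (subst v a) p A = p A" for A
    proof -
      have "{x. subst v a x \<in> A} \<inter> lists S = A \<inter> lists S"
        using subst_lists[OF assms] by fastforce
      then have "p {x. subst v a x \<in> A} = p A"
        using p(1) by (intro ultra_cong[of _ "lists S"]) (simp_all add: BS_def)
      then show ?thesis
        by (simp add: push_def)
    qed
    then have pp: "push (subst v a) p = p"
      by blast
    show "conv (push (subst v a) q) (push (subst v a) q) = push (subst v a) q"
      by (simp add: hom[symmetric] qq)
    show "conv (push (subst v a) q) p = push (subst v a) q"
      using hom[of q p] by (simp add: qp pp)
    show "conv p (push (subst v a) q) = push (subst v a) q"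
      using hom[of p q] by (simp add: pq pp)
    have "q {x. subst v a x \<in> lists S}"
      using qV subst_in_lists[OF a] by (auto simp: BV_def intro: ultra_mono[of q "var_words S v"])
    then show "push (subst v a) q \<in> BS"
      using qV by (auto simp: BS_def BV_def ultra_push) (simp add: push_def)
  qed
  then show thesis
    using that[of p q] p qp pq qq qV by (simp add: BS_def BV_def)
qed

section \<open>From the idempotents to an infinite sequence of variable words\<close>

definition inst :: "'a \<Rightarrow> 'a list \<Rightarrow> 'a list list \<Rightarrow> 'a list" where
  "inst v a ws = concat (map2 (subst v) a ws)"

lemma inst_Nil [simp]: "inst v [] ws = []" "inst v a [] = []"
  by (simp_all add: inst_def)

lemma inst_Cons [simp]: "inst v (b # a) (w # ws) = subst v b w @ inst v a ws"
  by (simp add: inst_def)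

lemma inst_append:
  "length a = length ws \<Longrightarrow> inst v (a @ b) (ws @ ws') = inst v a ws @ inst v b ws'"
  by (simp add: inst_def)

theorem carlson:
  assumes "finite S" "v \<notin> S"
  obtains w where "w \<in> inf_seqs S v"
    "(\<forall>a. set a \<subseteq> insert v S \<longrightarrow> v \<in> set a \<longrightarrow> inst v a (prefix (length a) w) \<in> C) \<or>
     (\<forall>a. set a \<subseteq> insert v S \<longrightarrow> v \<in> set a \<longrightarrow> inst v a (prefix (length a) w) \<notin> C)"
proof -
  obtain p q where p: "ultra p" "p (lists S)" and q: "ultra q" "q (var_words S v)"
    and pp: "conv p p = p" and qq: "conv q q = q" and pq: "conv p q = q" and qp: "conv q p = q"
    and push: "\<And>a. a \<in> S \<Longrightarrow> push (subst v a) q = p"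
    using ex_carlson_ultrafilters[OF assms(2)] by metis
  obtain A where A: "q A" "A = C \<or> A = - C"
    using ultra_Compl[OF q(1)] by blast
  define quot where "quot z = {y. z @ y \<in> A}" for z
  \<comment> \<open>The invariant of a partial product \<open>z\<close>. A constant \<open>z\<close>
    only has to enter \<open>A\<close> along \<open>q\<close>; once the variable has occurred,
    \<open>z\<close> must lie in \<open>A\<close> and must also stay there after p-typical constant
    continuations.\<close>
  define good where "good z \<longleftrightarrow> z \<in> lists S \<and> q (quot z) \<or> z \<in> A \<and> q (quot z) \<and> p (quot z)" for z
  have convD: "r {x. s (quot (z @ x))}" if "conv r s = t" "t (quot z)" for r s t z
    using that unfolding conv_def quot_def by auto
  have pushD: "q {w. subst v a w \<in> X}" if "a \<in> S" "p X" for a X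
    using push[OF that(1)] that(2) unfolding push_def by (metis)
  \<comment> \<open>qq = q and qp = q serve the case that the variable is kept; pq = q and pp = p
    serve a letter, whose substitution turns \<open>q\<close> into \<open>p\<close>.\<close>
  have step: "q {w. good (z @ subst v a w)}" if z: "good z" and a: "a \<in> insert v S" for z a
  proof (cases "a = v")
    case True
    have "q (quot z)"
      using z by (auto simp: good_def)
    then have "q (quot z \<inter> ({w. q (quot (z @ w))} \<inter> {w. p (quot (z @ w))}))"
      using convD[OF qq] convD[OF qp] by (simp add: ultra_Int[OF q(1)])
    then show ?thesis
      by (rule ultra_mono[OF q(1)]) (auto simp: True good_def quot_def)
  next
    case False
    then have a: "a \<in> S"
      using a by simp
    have qz: "q {w. q (quot (z @ subst v a w))}"
      using z convD[OF pq] pushD[OF a, of "{x. q (quot (z @ x))}"] by (auto simp: good_def)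
    from z consider "z \<in> lists S" | "z \<in> A" "p (quot z)"
      by (auto simp: good_def)
    then show ?thesis
    proof cases
      case 1
      have "q (var_words S v \<inter> {w. q (quot (z @ subst v a w))})"
        using q qz by (simp add: ultra_Int)
      then show ?thesis
        by (rule ultra_mono[OF q(1)]) (use 1 subst_in_lists[OF a] in \<open>auto simp: good_def\<close>)
    next
      case 2
      have "q {w. p (quot (z @ subst v a w))}"
        using 2 convD[OF pp] pushD[OF a, of "{x. p (quot (z @ x))}"] by auto
      moreover have "q {w. subst v a w \<in> quot z}"
        using 2 pushD[OF a] by auto
      ultimately have "q ({w. p (quot (z @ subst v a w))} \<inter> ({w. subst v a w \<in> quot z} \<inter>
          {w. q (quot (z @ subst v a w))}))"
        using qz by (simp add: ultra_Int[OF q(1)])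
      then show ?thesis
        by (rule ultra_mono[OF q(1)]) (auto simp: good_def quot_def)
    qed
  qed
  define ok where "ok ws \<longleftrightarrow> ws \<in> lists (var_words S v) \<and>
    (\<forall>a. length a = length ws \<longrightarrow> set a \<subseteq> insert v S \<longrightarrow> good (inst v a ws))" for ws
  have ext: "\<exists>w. ok (ws @ [w])" if ws: "ok ws" for ws
  proof -
    \<comment> \<open>The finite alphabet leaves only finitely many conditions on the next word, and
      finitely many q-large sets have a common element.\<close>
    define I where "I = {a. set a \<subseteq> insert v S \<and> length a = length ws} \<times> insert v S"
    have "finite I"
      using assms(1) by (auto simp: I_def intro: finite_lists_length_eq)
    then have "q (\<Inter>(a, b)\<in>I. {w. good (inst v a ws @ subst v b w)})"
    proof (rule ultra_INT[OF _ q(1)])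
      fix i assume "i \<in> I"
      then obtain a b where i: "i = (a, b)" "set a \<subseteq> insert v S" "length a = length ws" "b \<in> insert v S"
        by (auto simp: I_def)
      then have "good (inst v a ws)"
        using ws by (simp add: ok_def)
      then have "q {w. good (inst v a ws @ subst v b w)}"
        using i(4) by (rule step)
      then show "q (case i of (a, b) \<Rightarrow> {w. good (inst v a ws @ subst v b w)})"
        by (simp add: i(1))
    qed
    then have "q (var_words S v \<inter> (\<Inter>(a, b)\<in>I. {w. good (inst v a ws @ subst v b w)}))"
      using q by (simp add: ultra_Int)
    then obtain w where w: "w \<in> var_words S v" "\<And>a b. (a, b) \<in> I \<Longrightarrow> good (inst v a ws @ subst v b w)"
      using ultra_nonempty[OF q(1)] by blast
    have "good (inst v a (ws @ [w]))" if len: "length a = Suc (length ws)" and "set a \<subseteq> insert v S" for a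
    proof -
      obtain a' b where "a = a' @ [b]"
        using len by (cases a rule: rev_cases) auto
      then show ?thesis
        using w(2)[of a' b] that by (simp add: I_def inst_append)
    qed
    then have "ok (ws @ [w])"
      using ws w(1) by (simp add: ok_def)
    then show ?thesis ..
  qed
  have "quot [] = A"
    by (simp add: quot_def)
  then have ok0: "ok []"
    using A(1) by (simp add: ok_def good_def)
  obtain f where f: "ok (f n) \<and> length (f n) = n" "\<exists>w. f (Suc n) = f n @ [w]" for n
  proof -
    have "\<exists>f. \<forall>n. (ok (f n) \<and> length (f n) = n) \<and> (\<exists>w. f (Suc n) = f n @ [w])"
    proof (rule dependent_nat_choice)
      show "\<exists>x. ok x \<and> length x = 0"
        using ok0 by auto
      show "\<exists>y. (ok y \<and> length y = Suc n) \<and> (\<exists>w. y = x @ [w])" if "ok x \<and> length x = n" for x n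
        using ext[of x] that by auto
    qed
    then show thesis
      using that by blast
  qed
  define w where "w n = last (f (Suc n))" for n
  have pre: "prefix n w = f n" for n
  proof (induction n)
    case 0
    then show ?case
      using f(1)[of 0] by simp
  next
    case (Suc n)
    then show ?case
      using f(2)[of n] by (auto simp: w_def)
  qed
  have goodw: "good (inst v a (prefix (length a) w))" if "set a \<subseteq> insert v S" for a
    using f(1)[of "length a"] that by (auto simp: ok_def pre)
  have w: "w n \<in> var_words S v" for n
  proof -
    have "ok (prefix (Suc n) w)"
      using f(1)[of "Suc n"] by (simp only: pre)
    then show ?thesis
      by (simp add: ok_def)
  qed
  \<comment> \<open>This excludes the first alternative of \<open>good\<close> for every product in
    which the variable survives, so that such a product lies in \<open>A\<close>.\<close>
  have notS: "inst v a ws \<notin> lists S" if "v \<in> set a" "set ws \<subseteq> var_words S v" "length a = length ws" for a ws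
    using that(3,1,2)
  proof (induction a ws rule: list_induct2)
    case (Cons b a x ws)
    then show ?case
      using assms(2) by (auto simp: var_words_def)
  qed simp
  have "inst v a (prefix (length a) w) \<in> A" if "set a \<subseteq> insert v S" "v \<in> set a" for a
  proof -
    have "inst v a (prefix (length a) w) \<notin> lists S"
      using w by (intro notS that(2)) auto
    then show ?thesis
      using goodw[OF that(1)] unfolding good_def by blast
  qed
  moreover have "w \<in> inf_seqs S v"
    using w by (simp add: inf_seqs_def)
  ultimately show thesis
    using that[of w] A(2) by auto
qed

section \<open>Rank of the Schreier families\<close>

lemma cord_cases: obtains "\<beta> = 0" | \<gamma> where "\<beta> = succ \<gamma>" | "is_limit \<beta>"
  by (auto simp: is_limit_def is_succ_def)

lemma not_less_zero_cord [simp]: "\<not> \<alpha> < (0::cord)"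
  by (simp add: not_less)

lemma less_succ_iff: "\<alpha> < succ \<beta> \<longleftrightarrow> \<alpha> \<le> \<beta>"
  using succ_le_iff[of \<beta> \<alpha>] by (metis not_le)

text \<open>The growth condition is restricted to values above \<open>z\<close> because
  multiplication by \<open>omega\<close> fixes 0; powers of omega start at 1.\<close>

lemma trec_mono:
  assumes "\<And>\<gamma>. z \<le> \<gamma> \<Longrightarrow> \<gamma> \<le> f \<gamma>" "\<alpha> \<le> \<beta>"
  shows "trec z f \<alpha> \<le> trec z f \<beta>"
  using assms(2)
proof (induction \<beta> arbitrary: \<alpha> rule: less_induct)
  case (less \<beta>)
  show ?case
  proof (cases "\<alpha> = \<beta>")
    case False
    then have "\<alpha> < \<beta>"
      using less.prems by simp
    show ?thesis
    proof (cases \<beta> rule: cord_cases)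
      case 1
      then show ?thesis
        using \<open>\<alpha> < \<beta>\<close> zero_le_cord[of \<alpha>] by (metis leD)
    next
      case (2 \<gamma>)
      then have IH: "trec z f \<delta> \<le> trec z f \<gamma>" if "\<delta> \<le> \<gamma>" for \<delta>
        using less.IH[of \<gamma>] that less_succ by simp
      have "trec z f \<alpha> \<le> trec z f \<gamma>"
        using IH \<open>\<alpha> < \<beta>\<close> 2 by (simp add: less_succ_iff)
      also have "\<dots> \<le> f (trec z f \<gamma>)"
        using assms(1) IH[of 0] by (simp add: trec_clauses)
      finally show ?thesis
        by (simp add: 2 trec_clauses)
    next
      case 3
      show ?thesis
        unfolding trec_clauses(3)[OF 3]
        by (rule cSUP_upper) (use \<open>\<alpha> < \<beta>\<close> in \<open>auto intro!: countable_imp_bdd_above countable_image countable_cord_lessThan\<close>)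
    qed
  qed simp
qed

lemma trec_strict_mono:
  assumes "\<And>\<gamma>. z \<le> \<gamma> \<Longrightarrow> \<gamma> < f \<gamma>"
  shows "strict_mono (trec z f)"
proof (rule strict_monoI)
  fix \<alpha> \<beta> :: cord assume "\<alpha> < \<beta>"
  have mono: "trec z f \<gamma> \<le> trec z f \<delta>" if "\<gamma> \<le> \<delta>" for \<gamma> \<delta>
    using that assms by (intro trec_mono) (auto intro: less_imp_le)
  have "trec z f \<alpha> < trec z f (succ \<alpha>)"
    using assms mono[of 0 \<alpha>] by (simp add: trec_clauses)
  also have "\<dots> \<le> trec z f \<beta>"
    using \<open>\<alpha> < \<beta>\<close> by (intro mono) (simp add: succ_le_iff)
  finally show "trec z f \<alpha> < trec z f \<beta>" .
qed

lemma strict_mono_cord_ge: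
  fixes f :: "cord \<Rightarrow> cord"
  assumes "strict_mono f"
  shows "\<alpha> \<le> f \<alpha>"
proof (induction \<alpha> rule: less_induct)
  case (less \<alpha>)
  show ?case
  proof (rule ccontr)
    assume "\<not> \<alpha> \<le> f \<alpha>"
    then have "f \<alpha> < \<alpha>"
      by simp
    then show False
      using less.IH[of "f \<alpha>"] strict_monoD[OF assms, of "f \<alpha>" \<alpha>] by simp
  qed
qed

lemma strict_mono_plus_cord: "strict_mono ((+) (\<alpha>::cord))"
proof -
  have eq: "(+) \<alpha> = trec \<alpha> succ"
    by (rule ext) (rule plus_cord_def)
  show ?thesis
    unfolding eq by (rule trec_strict_mono[OF less_succ])
qed

lemma plus_cord_0: "(\<alpha>::cord) + 0 = \<alpha>"
  by (simp add: plus_cord_def trec_clauses)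

lemma less_times_omega:
  assumes "1 \<le> \<gamma>"
  shows "\<gamma> < \<gamma> * omega"
proof -
  have le: "x \<le> x + \<gamma>" for x
    using monoD[OF strict_mono_mono[OF strict_mono_plus_cord], of 0 \<gamma> x] by (simp add: plus_cord_0)
  have "0 < \<gamma>"
    using assms less_succ[of 0] by (simp add: one_cord_def succ_le_iff)
  \<comment> \<open>The recursion unfolds gamma * 2 to (0 + gamma) + gamma, and this inequality
    absorbs the initial 0.\<close>
  have "\<gamma> \<le> 0 + \<gamma>"
    by (rule strict_mono_cord_ge[OF strict_mono_plus_cord])
  also have "\<dots> = (0 + \<gamma>) + 0"
    by (simp add: plus_cord_0)
  also have "\<dots> < (0 + \<gamma>) + \<gamma>"
    using \<open>0 < \<gamma>\<close> by (rule strict_monoD[OF strict_mono_plus_cord])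
  also have "\<dots> = \<gamma> * succ (succ 0)"
    by (simp only: times_cord_def trec_clauses)
  also have "\<dots> \<le> \<gamma> * omega"
  proof -
    have "succ (succ 0) = fin_ord 2"
      by (simp add: fin_ord_def numeral_2_eq_2)
    also have "\<dots> \<le> omega"
      unfolding omega_def by (rule cSUP_upper) (simp_all add: countable_imp_bdd_above)
    finally show ?thesis
      unfolding times_cord_def by (rule trec_mono[OF le])
  qed
  finally show ?thesis .
qed

lemma strict_mono_omega_pow: "strict_mono omega_pow"
proof -
  have eq: "omega_pow = trec 1 (\<lambda>\<gamma>. \<gamma> * omega)"
    by (rule ext) (rule omega_pow_def)
  show ?thesis
    unfolding eq by (rule trec_strict_mono[OF less_times_omega])
qed

lemmas omega_pow_less_iff = strict_mono_less[OF strict_mono_omega_pow]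
lemmas omega_pow_le_iff = strict_mono_less_eq[OF strict_mono_omega_pow]
lemmas omega_pow_eq_iff = strict_mono_eq[OF strict_mono_omega_pow]

lemma omega_pow_0: "omega_pow 0 = 1"
  by (simp add: omega_pow_def trec_clauses)

lemma omega_pow_neq_0 [simp]: "omega_pow \<alpha> \<noteq> 0"
proof -
  have "0 < omega_pow 0"
    by (simp add: omega_pow_0 one_cord_def less_succ)
  also have "\<dots> \<le> omega_pow \<alpha>"
    by (simp add: omega_pow_le_iff)
  finally show ?thesis
    by simp
qed

section \<open>The topmost block of a Schreier set\<close>

lemma chain_union_lastE:
  assumes "chain_union P n s" "n \<ge> 1"
  obtains a b where "s = a \<union> b" "set_less a b" "P b"
proof -
  obtain xs where xs: "length xs = n" "\<forall>x\<in>set xs. P x" "sorted_wrt set_less xs" "s = \<Union>(set xs)"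
    using assms(1) by (auto simp: chain_union_def)
  then obtain ys y where "xs = ys @ [y]"
    using assms(2) by (metis append_butlast_last_id list.size(3) not_one_le_zero)
  then show thesis
    using that[of "\<Union>(set ys)" y] xs by (auto simp: sorted_wrt_append set_less_def)
qed

text \<open>The parts are listed in descending order, so the summand of highest exponent sits at the
  top of the set and its last chain member is a tail of the whole set. In the rank estimate this
  tail stands for the entire normal form.\<close>

lemma cnf_union_lastE:
  assumes "cnf_union P ((\<alpha>, p) # cs) s" "p \<ge> 1"
  obtains a b where "s = a \<union> b" "set_less a b" "P \<alpha> b"
proof -
  obtain s0 ss where ss: "chain_union (P \<alpha>) p s0" "\<forall>t\<in>set ss. set_less t s0" "s = s0 \<union> \<Union>(set ss)"
    using assms(1) by (auto simp: cnf_union_def list_all2_Cons1)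
  obtain a b where "s0 = a \<union> b" "set_less a b" "P \<alpha> b"
    using chain_union_lastE[OF ss(1) assms(2)] .
  then show thesis
    using that[of "a \<union> \<Union>(set ss)" b] ss by (auto simp: set_less_def)
qed

lemma chain_unions_finite:
  assumes "list_all2 (\<lambda>(a, p). chain_union (\<lambda>x. P a x \<and> finite x) p) cs ss"
  shows "\<forall>s\<in>set ss. finite s"
  using assms by (induction rule: list_all2_induct) (auto simp: chain_union_def)

lemma schreier_finite:
  assumes "schreier L \<xi> s"
  shows "finite s"
  using assms
proof induction
  case (cnf \<xi> \<alpha> p cs s)
  obtain ss where ss: "list_all2 (\<lambda>(a, p). chain_union (\<lambda>x. schreier L (omega_pow a) x \<and> finite x) p) ((\<alpha>, p) # cs) ss"
      "s = \<Union>(set ss)"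
    using cnf.IH unfolding cnf_union_def by blast
  show ?case
    using chain_unions_finite[OF ss(1)] by (simp add: ss(2))
qed auto

lemma schreier_nonempty:
  assumes "schreier L \<xi> s" "\<xi> \<noteq> 0"
  shows "s \<noteq> {}"
  using assms
proof induction
  case (omega_pow_succ ss \<beta>)
  then show ?case
    by (cases ss) auto
next
  case (cnf \<xi> \<alpha> p cs s)
  have "p \<ge> 1"
    using cnf.hyps by (simp add: is_cnf_def)
  then obtain a b where "s = a \<union> b" "schreier L (omega_pow \<alpha>) b \<and> (omega_pow \<alpha> \<noteq> 0 \<longrightarrow> b \<noteq> {})"
    using cnf_union_lastE[OF cnf.IH(1)] by metis
  then show ?case
    by simp
qed auto

section \<open>Lower bounds for ranks by derived families\<close>

definition slice :: "nat \<Rightarrow> nat set set \<Rightarrow> nat set set" where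
  "slice n A = {s. set_less {n} s \<and> insert n s \<in> A}"

text \<open>
  \<open>long \<alpha> A\<close> bounds the rank of the tree of initial segments of members of \<open>A\<close> from below. An
  empty slice counts as having every rank; this is harmless because \<open>long\<close> is only applied to trees
  all of whose branches are known to pass through \<open>A\<close>.
\<close>

function long :: "cord \<Rightarrow> nat set set \<Rightarrow> bool" where
  "long \<alpha> A \<longleftrightarrow> (\<forall>\<beta>. \<beta> < \<alpha> \<longrightarrow> {} \<notin> A \<and> (\<exists>n0. \<forall>n\<ge>n0. long \<beta> (slice n A)))"
  by pat_completeness auto
termination
proof (relation "inv_image {(x, y). x < y} fst")
  show "wf (inv_image {(x, y :: cord). x < y} (fst :: cord \<times> nat set set \<Rightarrow> cord))"
    by (intro wf_inv_image wf)
qed auto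

declare long.simps [simp del]

lemma longI:
  "(\<And>\<beta>. \<beta> < \<alpha> \<Longrightarrow> {} \<notin> A) \<Longrightarrow> (\<And>\<beta>. \<beta> < \<alpha> \<Longrightarrow> \<exists>n0. \<forall>n\<ge>n0. long \<beta> (slice n A)) \<Longrightarrow> long \<alpha> A"
  by (subst long.simps) blast

lemma longD:
  assumes "long \<alpha> A" "\<beta> < \<alpha>"
  shows "{} \<notin> A" "\<exists>n0. \<forall>n\<ge>n0. long \<beta> (slice n A)"
  using assms by (auto simp: long.simps[of \<alpha>])

lemma slice_mono: "A \<subseteq> B \<Longrightarrow> slice n A \<subseteq> slice n B"
  by (auto simp: slice_def)

lemma slice_Un: "slice n (A \<union> B) = slice n A \<union> slice n B"
  by (auto simp: slice_def)

text \<open>Unfolding \<open>long\<close> only ever demands that the empty set be absent from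
  iterated slices, so removing members does no harm. Hence it is enough to treat families that
  contain the Schreier family.\<close>

lemma long_subset: "long \<alpha> B \<Longrightarrow> A \<subseteq> B \<Longrightarrow> long \<alpha> A"
proof (induction \<alpha> arbitrary: A B rule: less_induct)
  case (less \<alpha>)
  show ?case
  proof (rule longI)
    fix \<beta> assume "\<beta> < \<alpha>"
    note D = longD[OF less.prems(1) this]
    show "{} \<notin> A"
      using D(1) less.prems(2) by blast
    show "\<exists>n0. \<forall>n\<ge>n0. long \<beta> (slice n A)"
      using D(2) less.IH[OF \<open>\<beta> < \<alpha>\<close>] slice_mono[OF less.prems(2)] by blast
  qed
qed

lemma long_le: "long \<alpha> A \<Longrightarrow> \<beta> \<le> \<alpha> \<Longrightarrow> long \<beta> A"
  by (rule longI) (metis longD less_le_trans)+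

text \<open>Slices are controlled for all large \<open>n\<close> rather than for infinitely many, so
  two thresholds can be replaced by their maximum.\<close>

lemma long_Un: "long \<alpha> A \<Longrightarrow> long \<alpha> B \<Longrightarrow> long \<alpha> (A \<union> B)"
proof (induction \<alpha> arbitrary: A B rule: less_induct)
  case (less \<alpha>)
  show ?case
  proof (rule longI)
    fix \<beta> assume b: "\<beta> < \<alpha>"
    note D = longD[OF less.prems(1) b] longD[OF less.prems(2) b]
    show "{} \<notin> A \<union> B"
      using D by blast
    obtain n0 n1 where "\<forall>n\<ge>n0. long \<beta> (slice n A)" "\<forall>n\<ge>n1. long \<beta> (slice n B)"
      using D by blast
    then have "\<forall>n\<ge>max n0 n1. long \<beta> (slice n A \<union> slice n B)"
      using less.IH[OF b] by simp
    then show "\<exists>n0. \<forall>n\<ge>n0. long \<beta> (slice n (A \<union> B))"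
      unfolding slice_Un by blast
  qed
qed

lemma long_empty: "long \<alpha> {}"
proof (induction \<alpha> rule: less_induct)
  case (less \<alpha>)
  have "slice n {} = {}" for n
    by (simp add: slice_def)
  then show ?case
    using less.IH by (intro longI) simp_all
qed

text \<open>Elements placed in front of a member of \<open>B\<close> can only delay its completion,
  so \<open>long\<close> is preserved (\<open>long_with_tail\<close>).\<close>

definition with_tail :: "nat set set \<Rightarrow> nat set set" where
  "with_tail B = {a \<union> b | a b. set_less a b \<and> b \<in> B}"

text \<open>Deleting the least element either shortens the part in front of the tail or, if that
  part is empty, begins to consume the tail.\<close>

lemma slice_with_tail: "slice n (with_tail B) \<subseteq> slice n B \<union> with_tail B"
proof
  fix s assume "s \<in> slice n (with_tail B)"
  then obtain a b where ab: "insert n s = a \<union> b" "set_less a b" "b \<in> B" "set_less {n} s"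
    by (auto simp: slice_def with_tail_def)
  show "s \<in> slice n B \<union> with_tail B"
  proof (cases "n \<in> a")
    case True
    then have "s = (a - {n}) \<union> b"
      using ab by (auto simp: set_less_def)
    moreover have "set_less (a - {n}) b"
      using ab(2) by (auto simp: set_less_def)
    ultimately show ?thesis
      using ab(3) by (auto simp: with_tail_def)
  next
    case False
    then have "n \<in> b"
      using ab(1) by auto
    have "x \<notin> a" for x
    proof
      assume "x \<in> a"
      then have "x < n" "x \<in> insert n s"
        using ab(1,2) \<open>n \<in> b\<close> by (auto simp: set_less_def)
      then show False
        using ab(4) by (auto simp: set_less_def)
    qed
    then have "b = insert n s"
      using ab(1) by auto
    then show ?thesis
      using ab by (auto simp: slice_def)
  qed
qed

lemma long_with_tail: "long \<alpha> B \<Longrightarrow> long \<alpha> (with_tail B)"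
proof (induction \<alpha> rule: less_induct)
  case (less \<alpha>)
  show ?case
  proof (rule longI)
    fix \<beta> assume b: "\<beta> < \<alpha>"
    note D = longD[OF less.prems b]
    show "{} \<notin> with_tail B"
      using D(1) by (auto simp: with_tail_def)
    have "long \<beta> (with_tail B)"
      using less.IH[OF b] less.prems b by (meson long_le less_imp_le)
    then show "\<exists>n0. \<forall>n\<ge>n0. long \<beta> (slice n (with_tail B))"
      using D(2) long_Un slice_with_tail long_subset by meson
  qed
qed

text \<open>The number of blocks equals the least element, which is \<open>n\<close>. For n >= 2
  there is a block after the first, and removing \<open>n\<close> from the first block leaves the
  last one intact.\<close>

lemma slice_omega_pow_succ:
  assumes "n \<ge> 2" "ss \<noteq> []" "length ss = Min (hd ss)" "\<forall>s\<in>set ss. schreier L (omega_pow \<beta>) s"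
    "sorted_wrt set_less ss" "set_less {n} s" "insert n s = \<Union>(set ss)"
  shows "s \<in> with_tail {s. schreier L (omega_pow \<beta>) s}"
proof -
  obtain a r where ss: "ss = a # r"
    using assms(2) by (cases ss) auto
  have a: "finite a" "a \<noteq> {}"
    using assms(4) schreier_finite schreier_nonempty omega_pow_neq_0 by (force simp: ss)+
  have "n \<in> a"
  proof (rule ccontr)
    assume "n \<notin> a"
    then obtain b where b: "b \<in> set r" "n \<in> b"
      using assms(7) by (auto simp: ss)
    obtain x where "x \<in> a"
      using a by blast
    then have "x < n" "x \<in> insert n s"
      using b assms(5,7) by (auto simp: ss set_less_def)
    then show False
      using assms(6) by (auto simp: set_less_def)
  qed
  moreover have "n \<le> x" if "x \<in> a" for x
  proof -
    have "x \<in> insert n s"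
      using assms(7) that by (auto simp: ss)
    then show ?thesis
      using assms(6) by (auto simp: set_less_def)
  qed
  ultimately have "Min a = n"
    using a by (intro Min_eqI) auto
  then have "r \<noteq> []"
    using assms(1,3) by (auto simp: ss)
  then obtain r' b where r: "r = r' @ [b]"
    by (metis rev_exhaust)
  have less: "set_less a b" "\<And>c. c \<in> set r' \<Longrightarrow> set_less c b"
    using assms(5) by (auto simp: ss r sorted_wrt_append)
  then have "n \<notin> b"
    using \<open>n \<in> a\<close> by (auto simp: set_less_def)
  then have "s = ((a \<union> \<Union>(set r')) - {n}) \<union> b"
    using assms(6,7) by (auto simp: ss r set_less_def)
  moreover have "set_less ((a \<union> \<Union>(set r')) - {n}) b"
    using less by (auto simp: set_less_def)
  moreover have "schreier L (omega_pow \<beta>) b"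
    using assms(4) by (simp add: ss r)
  ultimately show ?thesis
    unfolding with_tail_def by blast
qed

lemma slice_schreier_succ: "slice n {insert m s | m s. set_less {m} s \<and> schreier L \<zeta> s} \<subseteq> {s. schreier L \<zeta> s}"
proof
  fix s assume "s \<in> slice n {insert m s | m s. set_less {m} s \<and> schreier L \<zeta> s}"
  then obtain m t where "insert n s = insert m t" "set_less {m} t" "schreier L \<zeta> t" "set_less {n} s"
    by (auto simp: slice_def)
  moreover have "m = n"
    using calculation by (auto simp: set_less_def) (metis insertE insertI1 less_asym)
  ultimately show "s \<in> {s. schreier L \<zeta> s}"
    by (auto simp: set_less_def) (metis insert_ident less_irrefl)
qed


text \<open>The second conjunct carries the limit clause. There the slice at \<open>n\<close> lies
  in the family with the varying exponent \<open>L \<eta> n\<close>, so an eventual bound whose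
  threshold depends on the family does not suffice. A uniform threshold is required, and 2 is one
  for successor exponents.\<close>

lemma long_schreier_aux:
  assumes L: "fundamental_system L"
  shows "(\<forall>\<rho>. omega_pow \<rho> \<le> \<xi> \<longrightarrow> long \<rho> {s. schreier L \<xi> s}) \<and>
    (\<forall>\<delta>. \<xi> = omega_pow (succ \<delta>) \<longrightarrow> (\<forall>n\<ge>2. long \<delta> (slice n {s. schreier L \<xi> s})))"
proof (induction \<xi> rule: less_induct)
  case (less \<xi>)
  have IH1: "long \<rho> {s. schreier L \<zeta> s}" if "\<zeta> < \<xi>" "omega_pow \<rho> \<le> \<zeta>" for \<zeta> \<rho>
    using less.IH that by blast
  have IH2: "long \<delta> (slice n {s. schreier L (omega_pow (succ \<delta>)) s})"
    if "omega_pow (succ \<delta>) < \<xi>" "n \<ge> 2" for \<delta> n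
    using less.IH that by blast
  \<comment> \<open>One family for each way in which \<open>schreier\<close> can produce members
    beyond 1. A clause that does not fit \<open>\<xi>\<close> gives the empty family, which
    \<open>long_empty\<close> covers.\<close>
  define A1 where "A1 = {s. \<exists>\<zeta> m t. \<xi> = succ \<zeta> \<and> s = insert m t \<and> set_less {m} t \<and> schreier L \<zeta> t}"
  define A2 where "A2 = {s. \<exists>\<beta> ss. \<xi> = omega_pow (succ \<beta>) \<and> s = \<Union>(set ss) \<and> ss \<noteq> [] \<and>
    length ss = Min (hd ss) \<and> (\<forall>s\<in>set ss. schreier L (omega_pow \<beta>) s) \<and> sorted_wrt set_less ss}"
  define A3 where "A3 = {s. \<exists>\<eta>. \<xi> = omega_pow \<eta> \<and> is_limit \<eta> \<and> s \<noteq> {} \<and> schreier L (omega_pow (L \<eta> (Min s))) s}"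
  define A4 where "A4 = {s. \<exists>\<alpha> p cs. omega_pow \<alpha> < \<xi> \<and> \<xi> < omega_pow (succ \<alpha>) \<and> p \<ge> 1 \<and>
    cnf_union (\<lambda>a. schreier L (omega_pow a)) ((\<alpha>, p) # cs) s}"
  have cover: "{s. schreier L \<xi> s} \<subseteq> A1 \<union> A2 \<union> A3 \<union> A4" if "\<xi> \<noteq> 0" "\<xi> \<noteq> 1"
  proof
    fix s assume "s \<in> {s. schreier L \<xi> s}"
    then have "schreier L \<xi> s"
      by simp
    then show "s \<in> A1 \<union> A2 \<union> A3 \<union> A4"
    proof cases
      case (succ n s' \<zeta>)
      then have "s \<in> A1"
        unfolding A1_def by auto
      then show ?thesis
        by blast
    next
      case (omega_pow_succ ss \<beta>)
      then have "s \<in> A2"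
        unfolding A2_def by blast
      then show ?thesis
        by blast
    next
      case (omega_pow_limit \<eta>)
      then have "s \<in> A3"
        unfolding A3_def by blast
      then show ?thesis
        by blast
    next
      case (cnf \<alpha> p cs)
      then have "p \<ge> 1"
        by (simp add: is_cnf_def)
      with cnf have "s \<in> A4"
        unfolding A4_def by blast
      then show ?thesis
        by blast
    qed (use that in auto)
  qed
  have slice1: "\<exists>\<zeta>. \<xi> = succ \<zeta> \<and> slice n A1 \<subseteq> {s. schreier L \<zeta> s}" if "A1 \<noteq> {}" for n
  proof -
    obtain \<zeta> where \<zeta>: "\<xi> = succ \<zeta>"
      using \<open>A1 \<noteq> {}\<close> by (auto simp: A1_def)
    then have eq: "A1 = {insert m s | m s. set_less {m} s \<and> schreier L \<zeta> s}"
      by (auto simp: A1_def succ_inject)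
    have "slice n A1 \<subseteq> {s. schreier L \<zeta> s}"
      unfolding eq by (rule slice_schreier_succ)
    with \<zeta> show ?thesis
      by (intro exI conjI)
  qed
  have long1: "long \<beta> (slice n A1)" if "omega_pow \<beta> < \<xi>" for \<beta> n
  proof (cases "A1 = {}")
    case True
    then show ?thesis
      by (simp add: slice_def long_empty)
  next
    case False
    then obtain \<zeta> where \<zeta>: "\<xi> = succ \<zeta>" "slice n A1 \<subseteq> {s. schreier L \<zeta> s}"
      using slice1 by blast
    then have "long \<beta> {s. schreier L \<zeta> s}"
      using IH1[of \<zeta> \<beta>] that less_succ by (simp add: less_succ_iff)
    then show ?thesis
      using \<zeta>(2) long_subset by blast
  qed
  have long2: "long \<beta> (slice n A2)" if "omega_pow \<beta> < \<xi>" "n \<ge> 2" for \<beta> n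
  proof (cases "A2 = {}")
    case True
    then show ?thesis
      by (simp add: slice_def long_empty)
  next
    case False
    then obtain \<delta> where \<delta>: "\<xi> = omega_pow (succ \<delta>)"
      by (auto simp: A2_def)
    have sub: "slice n A2 \<subseteq> with_tail {s. schreier L (omega_pow \<delta>) s}"
    proof
      fix s assume "s \<in> slice n A2"
      then obtain ss where "set_less {n} s" "insert n s = \<Union>(set ss)" "ss \<noteq> []"
        "length ss = Min (hd ss)" "\<forall>s\<in>set ss. schreier L (omega_pow \<delta>) s" "sorted_wrt set_less ss"
        by (auto simp: slice_def A2_def \<delta> omega_pow_eq_iff succ_inject)
      then show "s \<in> with_tail {s. schreier L (omega_pow \<delta>) s}"
        using slice_omega_pow_succ that(2) by blast
    qed
    have "\<beta> \<le> \<delta>"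
      using that(1) by (simp add: \<delta> omega_pow_less_iff less_succ_iff)
    moreover have "long \<delta> {s. schreier L (omega_pow \<delta>) s}"
      by (rule IH1) (simp_all add: \<delta> omega_pow_less_iff less_succ)
    ultimately show ?thesis
      using sub long_subset long_with_tail long_le by blast
  qed
  have long3: "\<exists>n0. \<forall>n\<ge>n0. long \<beta> (slice n A3)" if "omega_pow \<beta> < \<xi>" for \<beta>
  proof (cases "A3 = {}")
    case True
    then show ?thesis
      by (simp add: slice_def long_empty)
  next
    case False
    then obtain \<eta> where \<eta>: "\<xi> = omega_pow \<eta>" "is_limit \<eta>"
      by (auto simp: A3_def)
    have F: "strict_mono_on {1..} (L \<eta>)" "\<And>n. n \<ge> 1 \<Longrightarrow> is_succ (L \<eta> n) \<and> L \<eta> n < \<eta>"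
      "(SUP n\<in>{1..}. L \<eta> n) = \<eta>"
      using L \<eta>(2) by (auto simp: fundamental_system_def)
    have "\<beta> < (SUP n\<in>{1..}. L \<eta> n)"
      using that unfolding F(3) by (simp add: \<eta>(1) omega_pow_less_iff)
    then obtain N where N: "N \<ge> 1" "\<beta> < L \<eta> N"
      by (subst (asm) less_cSUP_iff) (auto intro: countable_imp_bdd_above)
    have "long \<beta> (slice n A3)" if n: "n \<ge> max N 2" for n
    proof -
      have "L \<eta> N \<le> L \<eta> n"
        using strict_mono_onD[OF F(1), of N n] N(1) n by (cases "N = n") auto
      then have "\<beta> < L \<eta> n"
        using N(2) by simp
      \<comment> \<open>Fundamental sequences consist of successors, which makes the second part of
        the induction hypothesis available; beta < succ delta then turns into beta \<le>
        delta.\<close>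
      moreover obtain \<delta> where \<delta>: "L \<eta> n = succ \<delta>"
        using F(2)[of n] n by (auto simp: is_succ_def)
      ultimately have "\<beta> \<le> \<delta>"
        by (simp add: less_succ_iff)
      have "slice n A3 \<subseteq> slice n {s. schreier L (omega_pow (succ \<delta>)) s}"
      proof
        fix s assume "s \<in> slice n A3"
        then have s: "set_less {n} s" "schreier L (omega_pow (L \<eta> (Min (insert n s)))) (insert n s)"
          by (auto simp: slice_def A3_def \<eta>(1) omega_pow_eq_iff)
        then have "finite (insert n s)"
          by (intro schreier_finite)
        then have "Min (insert n s) = n"
          using s(1) by (intro Min_eqI) (auto simp: set_less_def)
        then show "s \<in> slice n {s. schreier L (omega_pow (succ \<delta>)) s}"
          using s by (simp add: slice_def \<delta>)
      qed
      moreover have "long \<delta> (slice n {s. schreier L (omega_pow (succ \<delta>)) s})"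
        using F(2)[of n] n \<delta> by (intro IH2) (auto simp: \<eta>(1) omega_pow_less_iff)
      ultimately show ?thesis
        using \<open>\<beta> \<le> \<delta>\<close> long_subset long_le by blast
    qed
    then show ?thesis
      by blast
  qed
  have long4: "long \<rho> A4" if "omega_pow \<rho> \<le> \<xi>" for \<rho>
  proof (cases "A4 = {}")
    case True
    then show ?thesis
      by (simp add: long_empty)
  next
    case False
    then obtain \<alpha> where \<alpha>: "omega_pow \<alpha> < \<xi>" "\<xi> < omega_pow (succ \<alpha>)"
      by (auto simp: A4_def)
    have "omega_pow \<rho> < omega_pow (succ \<alpha>)"
      using that \<alpha>(2) by simp
    then have "\<rho> \<le> \<alpha>"
      by (simp add: omega_pow_less_iff less_succ_iff)
    have "A4 \<subseteq> with_tail {s. schreier L (omega_pow \<alpha>) s}"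
    proof
      fix s assume "s \<in> A4"
      then obtain \<alpha>' p cs where s: "omega_pow \<alpha>' < \<xi>" "\<xi> < omega_pow (succ \<alpha>')" "p \<ge> 1"
        "cnf_union (\<lambda>a. schreier L (omega_pow a)) ((\<alpha>', p) # cs) s"
        by (auto simp: A4_def)
      \<comment> \<open>Both exponents locate the same \<open>\<xi>\<close> between consecutive
        powers of omega, so they agree whichever normal forms produced the two members.\<close>
      have "omega_pow \<alpha>' < omega_pow (succ \<alpha>)" "omega_pow \<alpha> < omega_pow (succ \<alpha>')"
        using s(1,2) \<alpha> by simp_all
      then have "\<alpha>' = \<alpha>"
        by (simp add: omega_pow_less_iff less_succ_iff)
      then show "s \<in> with_tail {s. schreier L (omega_pow \<alpha>) s}"
        using cnf_union_lastE[OF s(4,3)] unfolding with_tail_def by blast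
    qed
    moreover have "long \<alpha> {s. schreier L (omega_pow \<alpha>) s}"
      using \<alpha>(1) by (intro IH1) auto
    ultimately show ?thesis
      using \<open>\<rho> \<le> \<alpha>\<close> long_subset long_with_tail long_le by blast
  qed
  have main: "long \<rho> {s. schreier L \<xi> s}" if "omega_pow \<rho> \<le> \<xi>" for \<rho>
  proof (cases "\<rho> = 0")
    case True
    then show ?thesis
      by (intro longI) simp_all
  next
    case False
    then have "0 < \<rho>"
      using zero_le_cord[of \<rho>] by (simp add: order_le_less)
    then have "omega_pow 0 < \<xi>"
      using that omega_pow_less_iff[of 0 \<rho>] by simp
    then have "1 < \<xi>"
      by (simp add: omega_pow_0)
    then have \<xi>: "\<xi> \<noteq> 0" "\<xi> \<noteq> 1"
      by auto
    have ne: "{} \<notin> {s. schreier L \<xi> s}"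
      using schreier_nonempty \<xi>(1) by blast
    have "\<exists>n0. \<forall>n\<ge>n0. long \<beta> (slice n {s. schreier L \<xi> s})" if "\<beta> < \<rho>" for \<beta>
    proof -
      have b: "omega_pow \<beta> < \<xi>"
        using \<open>omega_pow \<rho> \<le> \<xi>\<close> \<open>\<beta> < \<rho>\<close> omega_pow_less_iff[of \<beta> \<rho>] by simp
      obtain n3 where n3: "\<And>n. n \<ge> n3 \<Longrightarrow> long \<beta> (slice n A3)"
        using long3[OF b] by blast
      have "long \<rho> A4"
        by (rule long4[OF \<open>omega_pow \<rho> \<le> \<xi>\<close>])
      then obtain n4 where n4: "\<And>n. n \<ge> n4 \<Longrightarrow> long \<beta> (slice n A4)"
        using longD(2) \<open>\<beta> < \<rho>\<close> by blast
      have "long \<beta> (slice n {s. schreier L \<xi> s})" if "n \<ge> max 2 (max n3 n4)" for n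
      proof (rule long_subset)
        show "long \<beta> (slice n A1 \<union> slice n A2 \<union> slice n A3 \<union> slice n A4)"
          using that by (intro long_Un long1 long2 n3 n4 b) auto
        show "slice n {s. schreier L \<xi> s} \<subseteq> slice n A1 \<union> slice n A2 \<union> slice n A3 \<union> slice n A4"
          using slice_mono[OF cover[OF \<xi>]] by (simp add: slice_Un)
      qed
      then show ?thesis
        by blast
    qed
    with ne show ?thesis
      by (intro longI)
  qed
  have succ_case: "long \<delta> (slice n {s. schreier L \<xi> s})" if \<xi>: "\<xi> = omega_pow (succ \<delta>)" and n: "n \<ge> 2" for \<delta> n
  proof (rule long_subset)
    have d: "omega_pow \<delta> < \<xi>"
      by (simp add: \<xi> omega_pow_less_iff less_succ)
    show "long \<delta> (slice n A1 \<union> slice n A2)"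
      using n by (intro long_Un long1 long2 d)
    \<comment> \<open>The limit and normal-form families must be excluded outright here: the bounds
      above control their slices only for large n, not from 2 on.\<close>
    have A3: "A3 = {}"
      using \<xi> by (auto simp: A3_def omega_pow_eq_iff is_limit_def)
    have A4: "A4 = {}"
      unfolding A4_def \<xi> omega_pow_less_iff by (auto simp: less_succ_iff succ_le_iff)
    have "omega_pow 0 < \<xi>"
      unfolding \<xi> omega_pow_less_iff using zero_le_cord less_succ by (rule le_less_trans)
    then have "1 < \<xi>"
      by (simp add: omega_pow_0)
    then have "\<xi> \<noteq> 0" "\<xi> \<noteq> 1"
      by auto
    from cover[OF this] have "{s. schreier L \<xi> s} \<subseteq> A1 \<union> A2"
      unfolding A3 A4 Un_empty_right .
    then show "slice n {s. schreier L \<xi> s} \<subseteq> slice n A1 \<union> slice n A2"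
      unfolding slice_Un[symmetric] by (rule slice_mono)
  qed
  show ?case
    by (intro conjI allI impI main succ_case)
qed

theorem long_schreier:
  assumes "fundamental_system L" "omega_pow \<rho> \<le> \<xi>"
  shows "long \<rho> {s. schreier L \<xi> s}"
  using long_schreier_aux[OF assms(1)] assms(2) by blast

section \<open>Reductions\<close>

text \<open>
  \<open>reduce v A ws\<close> lets a sequence \<open>A\<close> of variable words act on \<open>ws\<close>: the letters of \<open>concat A\<close> are
  substituted for the variable in the successive words of \<open>ws\<close>. A reduction is thus the same thing as
  multiplication by a sequence of variable words, and transitivity becomes the associativity law
  \<open>reduce_reduce\<close>.
\<close>

fun reduce :: "'a \<Rightarrow> 'a list list \<Rightarrow> 'a list list \<Rightarrow> 'a list list" where
  "reduce v [] ws = []"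
| "reduce v (a # A) ws = inst v a (take (length a) ws) # reduce v A (drop (length a) ws)"

lemma length_reduce [simp]: "length (reduce v A ws) = length A"
  by (induction v A ws rule: reduce.induct) auto

lemma reduce_append:
  "length (concat A) = length ws \<Longrightarrow> reduce v (A @ B) (ws @ ws') = reduce v A ws @ reduce v B ws'"
  by (induction v A ws rule: reduce.induct) auto

lemma length_inst: "length a = length ws \<Longrightarrow> length (inst v a ws) = length (concat ws)"
  by (induction a ws rule: list_induct2) (auto simp: subst_def)

lemma subst_inst:
  "length a = length ws \<Longrightarrow> subst v b (inst v a ws) = inst v (subst v b a) ws"
proof (induction a ws rule: list_induct2)
  case (Cons c a w ws)
  have "subst v b (subst v c w) = subst v (if c = v then b else c) w"
    by (simp add: subst_def)
  then show ?case
    using Cons by (simp add: subst_append) (simp add: subst_def)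
qed (simp add: subst_def)

lemma inst_reduce:
  assumes "length (concat A) = length ws" "length b = length A"
  shows "inst v b (reduce v A ws) = inst v (inst v b A) ws"
  using assms
proof (induction v A ws arbitrary: b rule: reduce.induct)
  case (2 v a A ws)
  then obtain c b' where b: "b = c # b'" "length b' = length A"
    by (cases b) auto
  have la: "length a \<le> length ws"
    using 2(2) by simp
  have "inst v b (reduce v (a # A) ws) =
      inst v (subst v c a) (take (length a) ws) @ inst v (inst v b' A) (drop (length a) ws)"
    using 2(1)[of b'] 2(2) b la by (simp add: subst_inst)
  also have "\<dots> = inst v (subst v c a @ inst v b' A) (take (length a) ws @ drop (length a) ws)"
    using la by (subst inst_append) (simp_all add: subst_def)
  finally show ?case
    by (simp add: b)
qed simp

lemma length_concat_reduce:
  assumes "length (concat A) = length ws"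
  shows "length (concat (reduce v A ws)) = length (concat ws)"
  using assms
proof (induction v A ws rule: reduce.induct)
  case (2 v a A ws)
  have "length (concat (reduce v (a # A) ws)) =
      length (concat (take (length a) ws)) + length (concat (drop (length a) ws))"
    using 2 by (simp add: length_inst)
  also have "\<dots> = length (concat (take (length a) ws @ drop (length a) ws))"
    by (simp del: append_take_drop_id)
  finally show ?case
    by simp
qed simp

lemma reduce_reduce:
  assumes "length (concat B) = length A" "length (concat A) = length ws"
  shows "reduce v B (reduce v A ws) = reduce v (reduce v B A) ws"
  using assms
proof (induction B arbitrary: A ws)
  case (Cons b B)
  define A1 A2 where "A1 = take (length b) A" and "A2 = drop (length b) A"
  \<comment> \<open>The number of terms of \<open>ws\<close> that the part of \<open>A\<close>
    consumed by \<open>b\<close> uses up.\<close>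
  define n where "n = length (concat A1)"
  have A: "A = A1 @ A2" "length A1 = length b" "length A2 = length (concat B)"
    using Cons.prems(1) by (simp_all add: A1_def A2_def)
  have ws: "ws = take n ws @ drop n ws" "n = length (take n ws)"
      "length (concat A2) = length (drop n ws)"
    using Cons.prems(2) A by (simp_all add: n_def)
  have eq: "reduce v A ws = reduce v A1 (take n ws) @ reduce v A2 (drop n ws)"
    using reduce_append[of A1 "take n ws" v A2 "drop n ws"] ws A(1) by (simp add: n_def)
  have n: "length (inst v b A1) = n"
    using A(2) by (simp add: length_inst n_def)
  have "reduce v (b # B) (reduce v A ws) =
      inst v b (reduce v A1 (take n ws)) # reduce v B (reduce v A2 (drop n ws))"
    using A(2) by (simp add: eq)
  also have "\<dots> = inst v (inst v b A1) (take n ws) # reduce v (reduce v B A2) (drop n ws)"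
    using Cons.IH[of A2 "drop n ws"] A ws n_def by (simp add: inst_reduce)
  also have "\<dots> = reduce v (reduce v (b # B) A) ws"
    using n A by simp
  finally show ?case .
qed simp

lemma inst_var_words:
  assumes "a \<in> var_words S v" "ws \<in> fin_seqs S v" "length a = length ws"
  shows "inst v a ws \<in> var_words S v"
proof -
  have "set (inst v a ws) \<subseteq> insert v S \<and> (v \<in> set a \<longrightarrow> v \<in> set (inst v a ws))"
    if "length a = length ws" "set a \<subseteq> insert v S" "ws \<in> fin_seqs S v" for a
    using that
  proof (induction a ws rule: list_induct2)
    case (Cons c a w ws)
    then have "w \<in> var_words S v" "ws \<in> fin_seqs S v"
      by (simp_all add: fin_seqs_def)
    with Cons show ?case
      by (auto simp: var_words_def subst_def)
  qed simp
  then show ?thesis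
    using assms by (force simp: var_words_def)
qed

lemma reduce_fin_seqs:
  assumes "A \<in> fin_seqs S v" "ws \<in> fin_seqs S v" "length (concat A) = length ws"
  shows "reduce v A ws \<in> fin_seqs S v"
  using assms
proof (induction v A ws rule: reduce.induct)
  case (2 v a A ws)
  have "take (length a) ws \<in> fin_seqs S v" "drop (length a) ws \<in> fin_seqs S v"
    using 2(3) by (auto simp: fin_seqs_def dest: in_set_takeD in_set_dropD)
  then show ?case
    using 2 inst_var_words[of a S v "take (length a) ws"] by (simp add: fin_seqs_def)
qed (simp add: fin_seqs_def)

text \<open>The finite counterpart of \<open>reduction\<close> that uses up all of
  \<open>ws\<close>. Without the equation of lengths \<open>reduce\<close> would silently truncate,
  and the action laws would fail.\<close>

definition fred :: "'a set \<Rightarrow> 'a \<Rightarrow> 'a list list \<Rightarrow> 'a list list \<Rightarrow> bool" where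
  "fred S v ws t \<longleftrightarrow> (\<exists>A\<in>fin_seqs S v. length (concat A) = length ws \<and> t = reduce v A ws)"

lemma fredI: "A \<in> fin_seqs S v \<Longrightarrow> length (concat A) = length ws \<Longrightarrow> fred S v ws (reduce v A ws)"
  by (auto simp: fred_def)

lemma fred_Nil [simp]: "fred S v [] []"
  using fredI[of "[]"] by (simp add: fin_seqs_def)

lemma fred_append: "fred S v ws t \<Longrightarrow> fred S v ws' t' \<Longrightarrow> fred S v (ws @ ws') (t @ t')"
  unfolding fred_def by (force simp: reduce_append[symmetric] fin_seqs_def)

lemma fred_splitE:
  assumes "fred S v ws (t @ t')"
  obtains ws1 ws2 where "ws = ws1 @ ws2" "fred S v ws1 t" "fred S v ws2 t'"
proof -
  obtain A where A: "A \<in> fin_seqs S v" "length (concat A) = length ws" "t @ t' = reduce v A ws"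
    using assms by (auto simp: fred_def)
  define A1 A2 where "A1 = take (length t) A" and "A2 = drop (length t) A"
  define n where "n = length (concat A1)"
  have AA: "A = A1 @ A2"
    by (simp add: A1_def A2_def)
  have lA: "length t + length t' = length A"
    using arg_cong[OF A(3), of length] by simp
  have l: "length (concat A1) = length (take n ws)" "length (concat A2) = length (drop n ws)"
    using A(2) by (simp_all add: n_def AA)
  have "t @ t' = reduce v A1 (take n ws) @ reduce v A2 (drop n ws)"
    using reduce_append[OF l(1), of v A2 "drop n ws"] A(3) by (simp add: AA)
  moreover have "length t = length (reduce v A1 (take n ws))"
    using lA by (simp add: A1_def)
  ultimately have "t = reduce v A1 (take n ws)" "t' = reduce v A2 (drop n ws)"
    by simp_all
  moreover have "A1 \<in> fin_seqs S v" "A2 \<in> fin_seqs S v"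
    using A(1) by (simp_all add: AA fin_seqs_def)
  ultimately show thesis
    using that[of "take n ws" "drop n ws"] l by (auto simp: fred_def)
qed

lemma fred_trans:
  assumes "fred S v ws t" "fred S v t u"
  shows "fred S v ws u"
proof -
  obtain A B where "A \<in> fin_seqs S v" "length (concat A) = length ws" "t = reduce v A ws"
    "B \<in> fin_seqs S v" "length (concat B) = length t" "u = reduce v B t"
    using assms by (auto simp: fred_def)
  then show ?thesis
    using reduce_reduce[of B A ws v] reduce_fin_seqs[of B S v A] length_concat_reduce[of B A v]
    by (auto simp: fred_def)
qed

lemma length_concat_fred: "fred S v ws t \<Longrightarrow> length (concat t) = length (concat ws)"
  by (auto simp: fred_def length_concat_reduce)

lemma fred_fin_seqs: "fred S v ws t \<Longrightarrow> ws \<in> fin_seqs S v \<Longrightarrow> t \<in> fin_seqs S v"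
  by (auto simp: fred_def reduce_fin_seqs)

lemma fred_refl [simp]: "fred S v ws ws"
proof -
  \<comment> \<open>The one-letter words \<open>[v]\<close> act as the identity.\<close>
  have "reduce v (map (\<lambda>_. [v]) ws) ws = ws"
    by (induction ws) (simp_all add: inst_def)
  moreover have "map (\<lambda>_. [v]) ws \<in> fin_seqs S v" "length (concat (map (\<lambda>_. [v]) ws)) = length ws"
    by (auto simp: fin_seqs_def var_words_def length_concat o_def)
  ultimately show ?thesis
    using fredI[of "map (\<lambda>_. [v]) ws" S v ws] by simp
qed

lemma fred_Nil_right: "fred S v ws [] \<Longrightarrow> ws = []"
  unfolding fred_def by (metis length_reduce length_0_conv list.size(3) concat.simps(1))

section \<open>Reductions of infinite sequences through their prefixes\<close>

lemma prefix_fin_seqs: "w \<in> inf_seqs S v \<Longrightarrow> subsequence w i j \<in> fin_seqs S v"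
  by (auto simp: inf_seqs_def fin_seqs_def)

lemma suffix_inf_seqs: "w \<in> inf_seqs S v \<Longrightarrow> suffix n w \<in> inf_seqs S v"
  by (simp add: inf_seqs_def)

lemma conc_inf_seqs: "t \<in> fin_seqs S v \<Longrightarrow> w \<in> inf_seqs S v \<Longrightarrow> t \<frown> w \<in> inf_seqs S v"
  by (auto simp: inf_seqs_def fin_seqs_def conc_def)

text \<open>Reductions preserve the total number of letters, and longer prefixes have strictly more
  letters because words are non-empty. A finite reduct thus determines how many terms it uses, which
  later glues separately chosen prefixes together.\<close>

lemma fred_prefix_unique:
  assumes "w \<in> inf_seqs S v" "fred S v (prefix m w) t" "fred S v (prefix n w) t"
  shows "m = n"
proof -
  have mono: "strict_mono (\<lambda>n. length (concat (prefix n w)))"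
    using assms(1) by (auto simp: strict_mono_Suc_iff inf_seqs_def var_words_def)
  have "length (concat (prefix m w)) = length (concat (prefix n w))"
    using assms(2,3) length_concat_fred by metis
  then show ?thesis
    using strict_mono_eq[OF mono] by simp
qed

lemma fred_prefix_splitE:
  assumes "fred S v (prefix m w) (t @ t')"
  obtains l where "l \<le> m" "fred S v (prefix l w) t" "fred S v (subsequence w l m) t'"
proof -
  obtain ws1 ws2 where ws: "prefix m w = ws1 @ ws2" "fred S v ws1 t" "fred S v ws2 t'"
    using assms by (rule fred_splitE)
  have le: "length ws1 \<le> m"
    using arg_cong[OF ws(1), of length] by simp
  have "ws1 = prefix (length ws1) w"
    using arg_cong[OF ws(1), of "take (length ws1)"] le by (simp add: min_def)
  moreover have "ws2 = subsequence w (length ws1) m"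
    using arg_cong[OF ws(1), of "drop (length ws1)"] by simp
  ultimately show thesis
    using that[OF le] ws(2,3) by simp
qed

text \<open>With this form transitivity follows from the finite case, and a sequence is a reduction
  as soon as each of its prefixes is a finite one. Diagonal sequences and infinite tree branches are
  recognised in this way.\<close>

lemma reduction_iff:
  "reduction S v u w \<longleftrightarrow>
    u \<in> inf_seqs S v \<and> w \<in> inf_seqs S v \<and> (\<forall>n. \<exists>m. fred S v (prefix m w) (prefix n u))"
proof safe
  assume "reduction S v u w"
  then obtain k \<alpha> where uw: "u \<in> inf_seqs S v" "w \<in> inf_seqs S v"
    and k: "k 0 = 0" "strict_mono k" and \<alpha>: "\<And>j. \<alpha> j \<in> insert v S"
    "\<And>n. v \<in> \<alpha> ` {k n..<k (Suc n)}"
    and u: "\<And>n. u n = concat (map (\<lambda>j. subst v (\<alpha> j) (w j)) [k n..<k (Suc n)])"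
    unfolding reduction_def by blast
  show "u \<in> inf_seqs S v" "w \<in> inf_seqs S v"
    using uw by simp_all
  have kle: "k n \<le> k (Suc n)" for n
    using strict_monoD[OF k(2), of n "Suc n"] by simp
  have one: "fred S v (subsequence w (k n) (k (Suc n))) [u n]" for n
  proof -
    define a where "a = map \<alpha> [k n..<k (Suc n)]"
    have "v \<in> set a"
      using \<alpha>(2)[of n] by (simp add: a_def)
    moreover have "set a \<subseteq> insert v S"
      using \<alpha>(1) by (auto simp: a_def)
    ultimately have "a \<in> var_words S v"
      by (auto simp: var_words_def)
    moreover have "reduce v [a] (subsequence w (k n) (k (Suc n))) = [u n]"
      by (simp add: a_def u inst_def subsequence_def map2_map_map)
    ultimately show ?thesis
      using fredI[of "[a]" S v "subsequence w (k n) (k (Suc n))"] by (simp add: fin_seqs_def a_def)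
  qed
  have "fred S v (prefix (k n) w) (prefix n u)" for n
  proof (induction n)
    case (Suc n)
    have "prefix (k (Suc n)) w = prefix (k n) w @ subsequence w (k n) (k (Suc n))"
      using subsequence_append[where i = "k n" and j = "k (Suc n) - k n" and w = w] kle[of n] by simp
    then show ?case
      using fred_append[OF Suc one[of n]] by simp
  qed (simp add: k(1))
  then show "\<exists>m. fred S v (prefix m w) (prefix n u)" for n
    by blast
next
  assume uw: "u \<in> inf_seqs S v" "w \<in> inf_seqs S v" and "\<forall>n. \<exists>m. fred S v (prefix m w) (prefix n u)"
  then obtain k where k: "\<And>n. fred S v (prefix (k n) w) (prefix n u)"
    by metis
  have "\<exists>a. a \<in> var_words S v \<and> k (Suc n) = k n + length a \<and>
      u n = inst v a (subsequence w (k n) (k (Suc n)))" for n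
  proof -
    have "fred S v (prefix (k (Suc n)) w) (prefix n u @ [u n])"
      using k[of "Suc n"] by simp
    then obtain l where l: "l \<le> k (Suc n)" "fred S v (prefix l w) (prefix n u)"
      "fred S v (subsequence w l (k (Suc n))) [u n]"
      by (rule fred_prefix_splitE)
    \<comment> \<open>The cut found inside the longer prefix agrees with \<open>k n\<close> by
      uniqueness, so consecutive prefixes differ by exactly one block.\<close>
    then have lk: "l = k n"
      using fred_prefix_unique[OF uw(2) _ k[of n]] by simp
    obtain A where "A \<in> fin_seqs S v" "length (concat A) = k (Suc n) - k n"
      "[u n] = reduce v A (subsequence w (k n) (k (Suc n)))"
      using l(3) by (auto simp: fred_def lk)
    moreover from this obtain a where "A = [a]"
      by (cases A; cases "tl A") auto
    ultimately show ?thesis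
      using l(1) by (intro exI[of _ a]) (auto simp: fin_seqs_def lk)
  qed
  then obtain a where a: "\<And>n. a n \<in> var_words S v" "\<And>n. k (Suc n) = k n + length (a n)"
      "\<And>n. u n = inst v (a n) (subsequence w (k n) (k (Suc n)))"
    by metis
  have k0: "k 0 = 0"
    using fred_Nil_right[of S v "prefix (k 0) w"] k[of 0] by simp
  have smk: "strict_mono k"
    using a(1) by (auto simp: strict_mono_Suc_iff a(2) var_words_def)
  \<comment> \<open>The block containing position \<open>j\<close>; \<open>\<alpha> j\<close> is
    then the letter of that block's word at the corresponding offset.\<close>
  define blk where "blk j = (LEAST n. j < k (Suc n))" for j
  define \<alpha> where "\<alpha> j = a (blk j) ! (j - k (blk j))" for j
  have blk: "blk j = n" if "k n \<le> j" "j < k (Suc n)" for j n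
    unfolding blk_def
  proof (rule Least_equality)
    fix m assume "j < k (Suc m)"
    then have "k n < k (Suc m)"
      using that(1) by simp
    then show "n \<le> m"
      using strict_mono_less[OF smk, of n "Suc m"] by simp
  qed (rule that(2))
  have ex_blk: "\<exists>n. k n \<le> j \<and> j < k (Suc n)" for j
  proof -
    have "j < k (Suc j)"
      using strict_mono_imp_increasing[OF smk, of "Suc j"] by simp
    then have least: "j < k (Suc (blk j))"
      unfolding blk_def by (rule LeastI)
    have "k (blk j) \<le> j"
    proof (cases "blk j")
      case (Suc n)
      then have "\<not> j < k (Suc n)"
        using not_less_Least[of n "\<lambda>n. j < k (Suc n)"] by (simp add: blk_def)
      then show ?thesis
        using Suc by simp
    qed (simp add: k0)
    then show ?thesis
      using least by blast
  qed
  have blk': "blk (k n + i) = n" if "i < length (a n)" for i n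
    using that by (intro blk) (simp_all add: a(2))
  have map\<alpha>: "map \<alpha> [k n..<k (Suc n)] = a n" for n
    by (rule nth_equalityI) (simp_all add: a(2) \<alpha>_def blk')
  have img: "\<alpha> ` {k n..<k (Suc n)} = set (a n)" for n
    using arg_cong[OF map\<alpha>, of set n] by simp
  show "reduction S v u w"
    unfolding reduction_def
  proof (intro conjI uw exI[of _ k] exI[of _ \<alpha>] allI k0 smk)
    fix j
    obtain n where "k n \<le> j" "j < k (Suc n)"
      using ex_blk by blast
    then have "\<alpha> j \<in> set (a n)"
      unfolding img[symmetric] by simp
    then show "\<alpha> j \<in> insert v S"
      using a(1)[of n] by (auto simp: var_words_def)
  next
    fix n
    show "v \<in> \<alpha> ` {k n..<k (Suc n)}"
      using a(1)[of n] by (simp only: img) (simp add: var_words_def)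
    show "u n = concat (map (\<lambda>j. subst v (\<alpha> j) (w j)) [k n..<k (Suc n)])"
      unfolding a(3) map\<alpha>[symmetric] inst_def subsequence_def map2_map_map ..
  qed
qed

lemma reduction_inf_seqs: "reduction S v u w \<Longrightarrow> u \<in> inf_seqs S v" "reduction S v u w \<Longrightarrow> w \<in> inf_seqs S v"
  by (simp_all add: reduction_def)

lemma reduction_refl: "w \<in> inf_seqs S v \<Longrightarrow> reduction S v w w"
  unfolding reduction_iff by (blast intro: fred_refl)

lemma reduction_trans: "reduction S v u w \<Longrightarrow> reduction S v w x \<Longrightarrow> reduction S v u x"
  unfolding reduction_iff using fred_trans by metis

lemma reduction_suffixE:
  assumes "reduction S v u w"
  obtains m where "fred S v (prefix m w) (prefix n u)" "reduction S v (suffix n u) (suffix m w)"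
proof -
  have uw: "u \<in> inf_seqs S v" "w \<in> inf_seqs S v" and r: "\<And>n. \<exists>m. fred S v (prefix m w) (prefix n u)"
    using assms by (auto simp: reduction_iff)
  obtain m where m: "fred S v (prefix m w) (prefix n u)"
    using r by blast
  have "\<exists>l. fred S v (prefix l (suffix m w)) (prefix j (suffix n u))" for j
  proof -
    obtain l where "fred S v (prefix l w) (prefix n u @ prefix j (suffix n u))"
      using r[of "n + j"] by (auto simp: subsequence_append)
    then obtain i where i: "i \<le> l" "fred S v (prefix i w) (prefix n u)"
      "fred S v (subsequence w i l) (prefix j (suffix n u))"
      by (rule fred_prefix_splitE)
    then have "i = m"
      using fred_prefix_unique[OF uw(2) _ m] by simp
    moreover have "subsequence w m l = prefix (l - m) (suffix m w)" if "m \<le> l"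
      using that by simp
    ultimately show ?thesis
      using i by metis
  qed
  then show thesis
    using that m uw by (simp add: reduction_iff suffix_inf_seqs)
qed

lemma reduction_suffix_fred:
  assumes "reduction S v u w" "fred S v (prefix m w) (prefix n u)"
  shows "reduction S v (suffix n u) (suffix m w)"
  using reduction_suffixE[OF assms(1), of n] fred_prefix_unique[OF _ assms(2)] assms(1)
  by (metis reduction_inf_seqs(2))

lemma reduction_conc:
  assumes "w \<in> inf_seqs S v" "fred S v (prefix m w) t" "reduction S v z (suffix m w)"
  shows "reduction S v (t \<frown> z) w"
proof -
  have t: "t \<in> fin_seqs S v"
    using fred_fin_seqs[OF assms(2)] prefix_fin_seqs[OF assms(1)] by simp
  have "\<exists>l. fred S v (prefix l w) (prefix n (t \<frown> z))" for n
  proof (cases "n \<le> length t")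
    case True
    have "fred S v (prefix m w) (take n t @ drop n t)"
      using assms(2) by simp
    then obtain l where "fred S v (prefix l w) (take n t)"
      by (rule fred_prefix_splitE)
    then show ?thesis
      using True by auto
  next
    case False
    obtain l where l: "fred S v (prefix l (suffix m w)) (prefix (n - length t) z)"
      using assms(3) by (auto simp: reduction_iff)
    from fred_append[OF assms(2) l] have "fred S v (prefix (m + l) w) (prefix n (t \<frown> z))"
      using False by (simp add: subsequence_append)
    then show ?thesis ..
  qed
  moreover have "t \<frown> z \<in> inf_seqs S v"
    using t reduction_inf_seqs(1)[OF assms(3)] by (rule conc_inf_seqs)
  ultimately show ?thesis
    using assms(1) by (simp add: reduction_iff)
qed

section \<open>Fusion\<close>

lemma fusion_limit:
  assumes z: "\<And>n. reduction S v (z (Suc n)) (suffix 1 (z n))" and z0: "z 0 \<in> inf_seqs S v"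
  shows "reduction S v (suffix j (\<lambda>n. z n 0)) (z j)"
proof -
  define u where "u = (\<lambda>n. z n 0)"
  have inf: "z n \<in> inf_seqs S v" for n
    using z0 reduction_inf_seqs(1)[OF z] by (cases n) simp_all
  have "\<exists>m. fred S v (prefix m (z j)) (prefix n (suffix j u))" for n j
  proof (induction n arbitrary: j)
    case 0
    have "fred S v (prefix 0 (z j)) (prefix 0 (suffix j u))"
      by simp
    then show ?case ..
  next
    case (Suc n)
    obtain m1 where m1: "fred S v (prefix m1 (z (Suc j))) (prefix n (suffix (Suc j) u))"
      using Suc by blast
    \<comment> \<open>\<open>z (Suc j)\<close> reduces the tail of \<open>z j\<close>, so behind the
      retained term \<open>z j 0\<close> the finite reduct found for \<open>Suc j\<close> can be
      transported back.\<close>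
    obtain m2 where "fred S v (prefix m2 (suffix 1 (z j))) (prefix m1 (z (Suc j)))"
      using z[of j] unfolding reduction_iff by blast
    then have "fred S v ([z j 0] @ prefix m2 (suffix 1 (z j))) ([z j 0] @ prefix n (suffix (Suc j) u))"
      using fred_trans[OF _ m1] by (intro fred_append) simp_all
    moreover have "[y 0] @ prefix k (suffix 1 y) = prefix (Suc k) y" for y :: "nat \<Rightarrow> 'a list" and k
      using subsequence_append[where i = 1 and j = k and w = y] by (simp del: subseq_to_Suc) 
    moreover have "[z j 0] @ prefix n (suffix (Suc j) u) = prefix (Suc n) (suffix j u)"
      using subsequence_append[where i = 1 and j = n and w = "suffix j u"] by (simp add: u_def del: subseq_to_Suc)
    ultimately have "fred S v (prefix (Suc m2) (z j)) (prefix (Suc n) (suffix j u))"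
      by metis
    then show ?case ..
  qed
  moreover have "suffix j u \<in> inf_seqs S v"
    using inf by (simp add: inf_seqs_def u_def)
  ultimately show ?thesis
    using inf by (simp add: reduction_iff u_def)
qed

text \<open>The acting sequence has \<open>length ws\<close> letters in total, so the number and the
  lengths of its words are bounded.\<close>

lemma finite_fred:
  assumes "finite S"
  shows "finite {t. fred S v ws t}"
proof (rule finite_subset)
  define N where "N = length ws"
  let ?W = "{w. set w \<subseteq> insert v S \<and> length w \<le> N}"
  show "finite ((\<lambda>A. reduce v A ws) ` {A. set A \<subseteq> ?W \<and> length A \<le> N})"
    using assms by (intro finite_imageI finite_lists_length_le) (simp_all add: finite_lists_length_le)
  show "{t. fred S v ws t} \<subseteq> (\<lambda>A. reduce v A ws) ` {A. set A \<subseteq> ?W \<and> length A \<le> N}"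
  proof
    fix t assume "t \<in> {t. fred S v ws t}"
    then obtain A where A: "A \<in> fin_seqs S v" "length (concat A) = N" "t = reduce v A ws"
      by (auto simp: fred_def N_def)
    have "length A \<le> length (concat A)"
      using A(1) by (induction A) (auto simp: fin_seqs_def var_words_def Suc_le_eq neq_Nil_conv)
    moreover have "length a \<le> length (concat A)" if "a \<in> set A" for a
      using that by (induction A) auto
    ultimately show "t \<in> (\<lambda>A. reduce v A ws) ` {A. set A \<subseteq> ?W \<and> length A \<le> N}"
      using A by (intro image_eqI[of _ _ A]) (auto simp: fin_seqs_def var_words_def)
  qed
qed

text \<open>A dense hereditary property is made to hold for all finite reducts at once. The same
  \<open>m\<close> ties \<open>t\<close> to the tail: the terms that \<open>t\<close> uses are
  frozen while \<open>P t\<close> is arranged on what follows.\<close>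

lemma fusion:
  assumes "finite S" "x \<in> inf_seqs S v"
    and mono: "\<And>t y y'. P t y \<Longrightarrow> reduction S v y' y \<Longrightarrow> P t y'"
    and dense: "\<And>t y. t \<in> fin_seqs S v \<Longrightarrow> y \<in> inf_seqs S v \<Longrightarrow> \<exists>y'. reduction S v y' y \<and> P t y'"
  obtains u where "reduction S v u x" "\<And>m t. fred S v (prefix m u) t \<Longrightarrow> P t (suffix m u)"
proof -
  have dense_finite: "\<exists>y'. reduction S v y' y \<and> (\<forall>t\<in>T. P t y')"
    if "finite T" "T \<subseteq> fin_seqs S v" "y \<in> inf_seqs S v" for T y
    using that
  proof (induction T rule: finite_induct)
    case empty
    then show ?case
      using reduction_refl[of y] by auto
  next
    case (insert t T)
    then obtain y' where y': "reduction S v y' y" "\<forall>t\<in>T. P t y'"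
      by auto
    have "t \<in> fin_seqs S v" "y' \<in> inf_seqs S v"
      using insert.prems(1) reduction_inf_seqs(1)[OF y'(1)] by auto
    then obtain y'' where y'': "reduction S v y'' y'" "P t y''"
      using dense by blast
    have "reduction S v y'' y"
      using y''(1) y'(1) by (rule reduction_trans)
    moreover have "P r y''" if "r \<in> T" for r
      using y'(2) that y''(1) by (auto intro: mono)
    ultimately show ?case
      using y''(2) by auto
  qed
  define ok where "ok = (\<lambda>(ws, y). ws \<in> fin_seqs S v \<and> y \<in> inf_seqs S v \<and> (\<forall>t. fred S v ws t \<longrightarrow> P t y))"
  \<comment> \<open>The first term of the tail is frozen and the rest is thinned. By
    \<open>finite_fred\<close> only finitely many sequences have to be treated at each
    stage.\<close>
  define next_of where "next_of = (\<lambda>(ws, y) (ws', y'). ws' = ws @ [y 0] \<and> reduction S v y' (suffix 1 y))"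
  have start: "\<exists>y. reduction S v y x \<and> ok ([], y)"
  proof -
    obtain y where "reduction S v y x" "\<forall>t\<in>{[]}. P t y"
      using dense_finite[of "{[]}" x] assms(2) by (auto simp: fin_seqs_def)
    moreover have "t = []" if "fred S v [] t" for t
      using length_concat_fred[OF that] fred_fin_seqs[OF that]
      by (cases t) (auto simp: fin_seqs_def var_words_def)
    ultimately show ?thesis
      using reduction_inf_seqs(1) by (intro exI[of _ y]) (auto simp: ok_def fin_seqs_def)
  qed
  have step: "\<exists>q. ok q \<and> next_of p q" if okp: "ok p" for p
  proof -
    obtain ws y where p: "p = (ws, y)" "ws \<in> fin_seqs S v" "y \<in> inf_seqs S v"
      using okp by (cases p) (auto simp: ok_def)
    have ws': "ws @ [y 0] \<in> fin_seqs S v"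
      using p by (simp add: fin_seqs_def inf_seqs_def)
    obtain y' where "reduction S v y' (suffix 1 y)" "\<forall>t\<in>{t. fred S v (ws @ [y 0]) t}. P t y'"
      using dense_finite[of "{t. fred S v (ws @ [y 0]) t}" "suffix 1 y"] finite_fred[OF assms(1)]
        fred_fin_seqs[OF _ ws'] suffix_inf_seqs[OF p(3)] by blast
    then show ?thesis
      using ws' reduction_inf_seqs(1)
      by (intro exI[of _ "(ws @ [y 0], y')"]) (auto simp: ok_def next_of_def p(1))
  qed
  obtain y0 where y0: "reduction S v y0 x" "ok ([], y0)"
    using start by blast
  obtain f where f: "\<And>n. ok (f n)" "f 0 = ([], y0)" "\<And>n. next_of (f n) (f (Suc n))"
  proof -
    have "\<exists>f. \<forall>n. (ok (f n) \<and> (n = 0 \<longrightarrow> f n = ([], y0))) \<and> next_of (f n) (f (Suc n))"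
      by (rule dependent_nat_choice) (use y0(2) step in auto)
    then show thesis
      using that by blast
  qed
  define z where "z n = snd (f n)" for n
  define u where "u = (\<lambda>n. z n 0)"
  have z: "reduction S v (z (Suc n)) (suffix 1 (z n))" for n
    using f(3)[of n] by (auto simp: next_of_def z_def split: prod.splits)
  have z0: "z 0 = y0"
    by (simp add: z_def f(2))
  have lim: "reduction S v (suffix j u) (z j)" for j
    unfolding u_def using z z0 y0(1) reduction_inf_seqs(1) by (intro fusion_limit) auto
  have pre: "prefix n u = fst (f n)" for n
  proof (induction n)
    case (Suc n)
    then show ?case
      using f(3)[of n] by (auto simp: next_of_def z_def u_def split: prod.splits)
  qed (simp add: f(2))
  show thesis
  proof (rule that)
    show "reduction S v u x"
      using lim[of 0] y0(1) z0 reduction_trans by fastforce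
    fix m t assume "fred S v (prefix m u) t"
    then have "P t (z m)"
      using f(1)[of m] by (auto simp: ok_def pre z_def split: prod.splits)
    then show "P t (suffix m u)"
      using lim by (rule mono)
  qed
qed

text \<open>The words that can begin a reduction of \<open>y\<close> are the products of variable
  words \<open>a\<close> with \<open>y\<close>. Carlson's theorem is applied to the colouring of
  \<open>a\<close> pulled back along this action, and \<open>y'\<close> is the resulting sequence
  \<open>A\<close> acting on \<open>y\<close>.\<close>

lemma pigeonhole:
  assumes "finite S" "v \<notin> S" "y \<in> inf_seqs S v"
  obtains y' where "reduction S v y' y"
    "(\<forall>m w. fred S v (prefix m y') [w] \<longrightarrow> w \<in> C) \<or> (\<forall>m w. fred S v (prefix m y') [w] \<longrightarrow> w \<notin> C)"
proof -
  obtain A where A: "A \<in> inf_seqs S v"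
    "(\<forall>a. set a \<subseteq> insert v S \<longrightarrow> v \<in> set a \<longrightarrow>
        inst v a (prefix (length a) A) \<in> {a. inst v a (prefix (length a) y) \<in> C}) \<or>
     (\<forall>a. set a \<subseteq> insert v S \<longrightarrow> v \<in> set a \<longrightarrow>
        inst v a (prefix (length a) A) \<notin> {a. inst v a (prefix (length a) y) \<in> C})"
    by (rule carlson[OF assms(1,2)])
  \<comment> \<open>The number of terms of \<open>y\<close> used by the first \<open>n\<close> terms
    of \<open>y'\<close>.\<close>
  define K where "K n = length (concat (prefix n A))" for n
  define y' where "y' n = inst v (A n) (subsequence y (K n) (K (Suc n)))" for n
  have K: "K (Suc n) = K n + length (A n)" for n
    by (simp add: K_def)
  have reduce: "reduce v (prefix n A) (prefix (K n) y) = prefix n y'" for n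
  proof (induction n)
    case (Suc n)
    have "prefix (K (Suc n)) y = prefix (K n) y @ subsequence y (K n) (K (Suc n))"
      unfolding K by (rule subsequence_append)
    then show ?case
      using Suc reduce_append[of "prefix n A" "prefix (K n) y" v "[A n]"] by (simp add: K_def y'_def)
  qed simp
  have fredK: "fred S v (prefix (K n) y) (prefix n y')" for n
  proof -
    have "length (concat (prefix n A)) = length (prefix (K n) y)"
      by (simp add: K_def)
    then show ?thesis
      using fredI[OF prefix_fin_seqs[OF A(1)]] reduce[of n] by metis
  qed
  have "y' \<in> inf_seqs S v"
    unfolding inf_seqs_def
  proof safe
    fix n
    have "prefix (Suc n) y' \<in> fin_seqs S v"
      using fred_fin_seqs[OF fredK] prefix_fin_seqs[OF assms(3)] by blast
    then show "y' n \<in> var_words S v"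
      by (simp add: fin_seqs_def)
  qed
  with assms(3) have red: "reduction S v y' y"
    using fredK by (auto simp: reduction_iff)
  have first: "\<exists>a. set a \<subseteq> insert v S \<and> v \<in> set a \<and>
      w = inst v (inst v a (prefix (length a) A)) (prefix (length (inst v a (prefix (length a) A))) y)"
    if w: "fred S v (prefix m y') [w]" for m w
  proof -
    obtain B where B: "B \<in> fin_seqs S v" "length (concat B) = m" "[w] = reduce v B (prefix m y')"
      using w by (auto simp: fred_def)
    then obtain b where b: "B = [b]"
      by (cases B; cases "tl B") auto
    have "w = inst v b (reduce v (prefix m A) (prefix (K m) y))"
      using B by (simp add: b reduce)
    also have "\<dots> = inst v (inst v b (prefix m A)) (prefix (K m) y)"
      using B(2) by (intro inst_reduce) (simp_all add: b K_def)
    finally show ?thesis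
      using B(1,2) by (intro exI[of _ b]) (auto simp: b length_inst K_def fin_seqs_def var_words_def)
  qed
  from A(2) show thesis
  proof
    assume *: "\<forall>a. set a \<subseteq> insert v S \<longrightarrow> v \<in> set a \<longrightarrow>
        inst v a (prefix (length a) A) \<in> {a. inst v a (prefix (length a) y) \<in> C}"
    have "w \<in> C" if "fred S v (prefix m y') [w]" for m w
      using first[OF that] * by auto
    then show thesis
      using that[OF red] by blast
  next
    assume *: "\<forall>a. set a \<subseteq> insert v S \<longrightarrow> v \<in> set a \<longrightarrow>
        inst v a (prefix (length a) A) \<notin> {a. inst v a (prefix (length a) y) \<in> C}"
    have "w \<notin> C" if "fred S v (prefix m y') [w]" for m w
      using first[OF that] * by auto
    then show thesis
      using that[OF red] by blast
  qed
qed

section \<open>The Nash-Williams dichotomy and the Ellentuck closure\<close>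

theorem nash_williams:
  assumes "finite S" "v \<notin> S" "x \<in> inf_seqs S v"
  obtains u where "reduction S v u x"
    "(\<forall>y. reduction S v y u \<longrightarrow> (\<exists>n. prefix n y \<in> F)) \<or>
     (\<forall>y n. reduction S v y u \<longrightarrow> prefix n y \<notin> F)"
proof -
  \<comment> \<open>Acceptance and rejection in the style of Nash-Williams and Galvin-Prikry. The
    case n = 0 is allowed, so a \<open>t\<close> in \<open>F\<close> is accepted by every sequence;
    the final contradiction rests on this.\<close>
  define acc where "acc t y \<longleftrightarrow> (\<forall>y'. reduction S v y' y \<longrightarrow> (\<exists>n. t @ prefix n y' \<in> F))" for t y
  define rej where "rej t y \<longleftrightarrow> (\<forall>y'. reduction S v y' y \<longrightarrow> \<not> acc t y')" for t y
  \<comment> \<open>The second alternative builds the inductive step into the property to be fused: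
    rejection passes from \<open>t\<close> to its one-word extensions.\<close>
  define P where "P t y \<longleftrightarrow> acc t y \<or> rej t y \<and>
    (\<forall>m w. fred S v (prefix m y) [w] \<longrightarrow> rej (t @ [w]) (suffix m y))" for t y
  have acc_mono: "acc t y'" if "acc t y" "reduction S v y' y" for t y y'
    unfolding acc_def
  proof (intro allI impI)
    fix z assume "reduction S v z y'"
    then have "reduction S v z y"
      using that(2) by (rule reduction_trans)
    then show "\<exists>n. t @ prefix n z \<in> F"
      using that(1) by (simp add: acc_def)
  qed
  have rej_mono: "rej t y'" if "rej t y" "reduction S v y' y" for t y y'
    unfolding rej_def
  proof (intro allI impI)
    fix z assume "reduction S v z y'"
    then have "reduction S v z y"
      using that(2) by (rule reduction_trans)
    then show "\<not> acc t z"
      using that(1) by (simp add: rej_def)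
  qed
  have not_both: "\<not> acc t y" if "rej t y" "y \<in> inf_seqs S v" for t y
    using that(1) reduction_refl[OF that(2)] by (simp add: rej_def)
  have first_mono: "\<exists>l. fred S v (prefix l y) [w] \<and> reduction S v (suffix m y') (suffix l y)"
    if y': "reduction S v y' y" and w: "fred S v (prefix m y') [w]" for y y' m w
  proof -
    obtain l where l: "fred S v (prefix l y) (prefix m y')" "reduction S v (suffix m y') (suffix l y)"
      by (rule reduction_suffixE[OF y'])
    with fred_trans[OF l(1) w] show ?thesis
      by blast
  qed
  have mono: "P t y'" if P: "P t y" and y': "reduction S v y' y" for t y y'
  proof (cases "acc t y")
    case True
    then show ?thesis
      using acc_mono[OF _ y'] by (simp add: P_def)
  next
    case False
    then have rej: "rej t y" "\<And>m w. fred S v (prefix m y) [w] \<Longrightarrow> rej (t @ [w]) (suffix m y)"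
      using P by (auto simp: P_def)
    have "rej (t @ [w]) (suffix m y')" if w: "fred S v (prefix m y') [w]" for m w
    proof -
      obtain l where l: "fred S v (prefix l y) [w]" "reduction S v (suffix m y') (suffix l y)"
        using first_mono[OF y' w] by (elim exE conjE)
      show ?thesis
        using rej(2)[OF l(1)] l(2) by (rule rej_mono)
    qed
    then show ?thesis
      using rej_mono[OF rej(1) y'] by (simp add: P_def)
  qed
  have decide: "\<exists>y'. reduction S v y' y \<and> (acc t y' \<or> rej t y')" if "y \<in> inf_seqs S v" for t y
  proof (cases "rej t y")
    case True
    then show ?thesis
      using reduction_refl[OF that] by (intro exI[of _ y]) simp
  next
    case False
    then obtain y' where "reduction S v y' y" "acc t y'"
      unfolding rej_def by auto
    then show ?thesis
      by (intro exI[of _ y']) simp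
  qed
  have dense: "\<exists>y'. reduction S v y' y \<and> P t y'" if y: "y \<in> inf_seqs S v" for t y
  proof (cases "\<exists>y'. reduction S v y' y \<and> acc t y'")
    case True
    then show ?thesis
      by (auto simp: P_def)
  next
    case False
    then have rej: "rej t y"
      by (auto simp: rej_def)
    obtain y1 where y1: "reduction S v y1 y"
      "\<And>m r. fred S v (prefix m y1) r \<Longrightarrow> acc (t @ r) (suffix m y1) \<or> rej (t @ r) (suffix m y1)"
    proof (rule fusion[OF assms(1) y, where P = "\<lambda>r z. acc (t @ r) z \<or> rej (t @ r) z"])
      fix r z z' assume "acc (t @ r) z \<or> rej (t @ r) z" "reduction S v z' z"
      then show "acc (t @ r) z' \<or> rej (t @ r) z'"
        using acc_mono[of "t @ r" z z'] rej_mono[of "t @ r" z z'] by auto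
    next
      fix z r assume "z \<in> inf_seqs S v"
      then show "\<exists>y'. reduction S v y' z \<and> (acc (t @ r) y' \<or> rej (t @ r) y')"
        by (rule decide)
    qed (rule that)
    have y1_inf: "y1 \<in> inf_seqs S v"
      using y1(1) by (rule reduction_inf_seqs(1))
    \<comment> \<open>First words whose addition to \<open>t\<close> leads to acceptance. If all
      first words were of this kind, \<open>t\<close> itself would be accepted, so only the other
      colour can occur.\<close>
    define C where "C = {w. \<exists>m. fred S v (prefix m y1) [w] \<and> acc (t @ [w]) (suffix m y1)}"
    obtain y2 where y2: "reduction S v y2 y1"
      "(\<forall>m w. fred S v (prefix m y2) [w] \<longrightarrow> w \<in> C) \<or> (\<forall>m w. fred S v (prefix m y2) [w] \<longrightarrow> w \<notin> C)"
      by (rule pigeonhole[OF assms(1,2) y1_inf])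
    have y2y: "reduction S v y2 y"
      using y2(1) y1(1) by (rule reduction_trans)
    from y2(2) show ?thesis
    proof
      assume C: "\<forall>m w. fred S v (prefix m y2) [w] \<longrightarrow> w \<in> C"
      have "acc t y2"
        unfolding acc_def
      proof (intro allI impI)
        fix y3 assume y3: "reduction S v y3 y2"
        have p1: "prefix 1 y3 = [y3 0]"
          by simp
        obtain l where "fred S v (prefix l y2) (prefix 1 y3)"
          by (rule reduction_suffixE[OF y3])
        then have "y3 0 \<in> C"
          using C unfolding p1 by blast
        then obtain m where m: "fred S v (prefix m y1) (prefix 1 y3)" "acc (t @ [y3 0]) (suffix m y1)"
          unfolding C_def p1 by blast
        have "reduction S v (suffix 1 y3) (suffix m y1)"
          using reduction_trans[OF y3 y2(1)] m(1) by (rule reduction_suffix_fred)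
        then obtain n where "(t @ [y3 0]) @ prefix n (suffix 1 y3) \<in> F"
          using m(2) unfolding acc_def by blast
        moreover have "[y3 0] @ prefix n (suffix 1 y3) = prefix (1 + n) y3"
          using subsequence_append[where i = 1 and j = n and w = y3] by simp
        ultimately have "t @ prefix (1 + n) y3 \<in> F"
          by (metis append_assoc)
        then show "\<exists>n. t @ prefix n y3 \<in> F"
          by blast
      qed
      then show ?thesis
        using False y2y by blast
    next
      assume C: "\<forall>m w. fred S v (prefix m y2) [w] \<longrightarrow> w \<notin> C"
      have "rej (t @ [w]) (suffix m y2)" if w: "fred S v (prefix m y2) [w]" for m w
      proof -
        obtain l where l: "fred S v (prefix l y1) [w]" "reduction S v (suffix m y2) (suffix l y1)"
          using first_mono[OF y2(1) w] by blast
        have "w \<notin> C"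
          using C w by blast
        then have "\<not> acc (t @ [w]) (suffix l y1)"
          using l(1) by (auto simp: C_def)
        then have "rej (t @ [w]) (suffix l y1)"
          using y1(2)[OF l(1)] by blast
        then show ?thesis
          using l(2) by (rule rej_mono)
      qed
      then have "P t y2"
        using rej_mono[OF rej y2y] by (simp add: P_def)
      then show ?thesis
        using y2y by blast
    qed
  qed
  obtain u where u: "reduction S v u x" "\<And>m t. fred S v (prefix m u) t \<Longrightarrow> P t (suffix m u)"
  proof (rule fusion[OF assms(1,3), where P = P])
    fix t y y' assume "P t y" "reduction S v y' y"
    then show "P t y'"
      by (rule mono)
  next
    fix t y assume "y \<in> inf_seqs S v"
    then show "\<exists>y'. reduction S v y' y \<and> P t y'"
      by (rule dense)
  qed (rule that)
  have u_inf: "u \<in> inf_seqs S v"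
    using u(1) by (rule reduction_inf_seqs(1))
  show thesis
  proof (cases "acc [] u")
    case True
    then show thesis
      using that[OF u(1)] by (simp add: acc_def)
  next
    case False
    have all: "rej t (suffix m u)" if "fred S v (prefix m u) t" for m t
      using that
    proof (induction t arbitrary: m rule: rev_induct)
      case Nil
      have "P [] (suffix 0 u)"
        by (rule u(2)) simp
      moreover have "m = 0"
        using fred_Nil_right[OF Nil] by simp
      ultimately show ?case
        using False by (simp add: P_def)
    next
      case (snoc w t)
      obtain l where l: "l \<le> m" "fred S v (prefix l u) t" "fred S v (subsequence u l m) [w]"
        using snoc.prems by (rule fred_prefix_splitE)
      have eq: "suffix (m - l) (suffix l u) = suffix m u" "prefix (m - l) (suffix l u) = subsequence u l m"
        using l(1) by simp_all
      have "rej t (suffix l u)"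
        using l(2) by (rule snoc.IH)
      then have "\<not> acc t (suffix l u)"
        using not_both suffix_inf_seqs[OF u_inf] by blast
      then have "\<forall>m w. fred S v (prefix m (suffix l u)) [w] \<longrightarrow> rej (t @ [w]) (suffix m (suffix l u))"
        using u(2)[OF l(2)] by (auto simp: P_def)
      from this[rule_format, of "m - l" w] show ?case
        using l(3) unfolding eq by blast
    qed
    have "prefix n y \<notin> F" if y: "reduction S v y u" for y n
    proof
      assume F: "prefix n y \<in> F"
      obtain m where m: "fred S v (prefix m u) (prefix n y)"
        by (rule reduction_suffixE[OF y])
      have "prefix n y @ prefix 0 z \<in> F" for z
        using F by simp
      then have "acc (prefix n y) (suffix m u)"
        unfolding acc_def by blast
      then show False
        using not_both[OF all[OF m]] suffix_inf_seqs[OF u_inf] by blast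
    qed
    then show thesis
      using that[OF u(1)] by blast
  qed
qed

section \<open>Ellentuck neighbourhoods and closure\<close>

lemma initial_segment_iff: "initial_segment s w \<longleftrightarrow> prefix (length s) w = s"
proof -
  have "prefix (length s) w = s \<longleftrightarrow> (\<forall>i<length s. w i = s ! i)"
    by (subst list_eq_iff_nth_eq) simp
  then show ?thesis
    unfolding initial_segment_def by (simp only: eq_commute)
qed

lemma seq_minus_eq: "seq_minus w s = suffix (length s) w"
  by (simp add: seq_minus_def suffix_def)

lemma basic_set_eq:
  assumes "s \<in> fin_seqs S v"
  shows "basic_set S v s y = {s \<frown> z | z. reduction S v z y}"
proof safe
  fix w assume "w \<in> basic_set S v s y"
  then have "prefix (length s) w = s" "reduction S v (suffix (length s) w) y"
    by (simp_all add: basic_set_def initial_segment_iff seq_minus_eq)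
  then show "\<exists>z. w = s \<frown> z \<and> reduction S v z y"
    using prefix_suffix[of w "length s"] by metis
next
  fix z assume z: "reduction S v z y"
  then show "s \<frown> z \<in> basic_set S v s y"
    using conc_inf_seqs[OF assms reduction_inf_seqs(1)[OF z]]
    by (simp add: basic_set_def initial_segment_iff seq_minus_eq)
qed

lemma basic_set_mono: "reduction S v y' y \<Longrightarrow> basic_set S v s y' \<subseteq> basic_set S v s y"
  by (auto simp: basic_set_def intro: reduction_trans)

lemma basic_set_extend:
  assumes "s \<in> fin_seqs S v" "y \<in> inf_seqs S v" "fred S v (prefix m y) r"
  shows "basic_set S v (s @ r) (suffix m y) \<subseteq> basic_set S v s y"
proof -
  have r: "r \<in> fin_seqs S v"
    using assms(3) prefix_fin_seqs[OF assms(2)] by (rule fred_fin_seqs)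
  then have sr: "s @ r \<in> fin_seqs S v"
    using assms(1) by (simp add: fin_seqs_def)
  show ?thesis
  proof
    fix w assume "w \<in> basic_set S v (s @ r) (suffix m y)"
    then obtain z where z: "w = (s @ r) \<frown> z" "reduction S v z (suffix m y)"
      unfolding basic_set_eq[OF sr] by blast
    then have "w = s \<frown> (r \<frown> z)"
      by simp
    then show "w \<in> basic_set S v s y"
      unfolding basic_set_eq[OF assms(1)] using reduction_conc[OF assms(2,3) z(2)] by blast
  qed
qed

text \<open>In the form for all large \<open>n\<close> the property survives finite intersections in
  the induction over the generated topology.\<close>

lemma openin_ellentuckD:
  assumes "openin (ellentuck S v) T" "w \<in> T"
  shows "\<exists>N. \<forall>n\<ge>N. basic_set S v (prefix n w) (suffix n w) \<subseteq> T"
proof -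
  have "generate_topology_on {basic_set S v s x | s x. s \<in> fin_seqs S v \<and> x \<in> inf_seqs S v} T"
    using assms(1) by (simp add: ellentuck_def openin_topology_generated_by_iff)
  then show ?thesis
    using assms(2)
  proof induction
    case (Int A B)
    then obtain M N where "\<forall>n\<ge>M. basic_set S v (prefix n w) (suffix n w) \<subseteq> A"
      "\<forall>n\<ge>N. basic_set S v (prefix n w) (suffix n w) \<subseteq> B"
      by blast
    then have "basic_set S v (prefix n w) (suffix n w) \<subseteq> A \<inter> B" if "n \<ge> max M N" for n
      using that by (meson Int_greatest max.boundedE)
    then show ?case
      by blast
  next
    case (UN K)
    then show ?case
      by (meson Union_upper UnionE subset_trans)
  next
    case (Basis T)
    then obtain s x where s: "T = basic_set S v s x" "s \<in> fin_seqs S v"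
      by blast
    then have w: "prefix (length s) w = s" "reduction S v (suffix (length s) w) x"
      using Basis(2) by (simp_all add: basic_set_def initial_segment_iff seq_minus_eq)
    have "basic_set S v (prefix n w) (suffix n w) \<subseteq> T" if n: "n \<ge> length s" for n
    proof -
      define m where "m = n - length s"
      have pre: "prefix n w = s @ prefix m (suffix (length s) w)"
        using subsequence_append[where i = "length s" and j = m and w = w] n w(1)
        by (simp add: m_def)
      have suf: "suffix n w = suffix m (suffix (length s) w)"
        using n by (simp add: m_def)
      have "basic_set S v (prefix n w) (suffix n w) \<subseteq> basic_set S v s (suffix (length s) w)"
        unfolding pre suf by (rule basic_set_extend[OF s(2) reduction_inf_seqs(1)[OF w(2)] fred_refl])
      also have "\<dots> \<subseteq> T"
        unfolding s(1) using w(2) by (rule basic_set_mono)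
      finally show ?thesis .
    qed
    then show ?case
      by blast
  qed simp
qed

text \<open>Every open set around \<open>w\<close> contains the neighbourhoods given by all long
  prefixes of \<open>w\<close>, so short prefixes need not be tested. In the application
  \<open>N\<close> is the length of \<open>s\<close>, since badness concerns extensions of
  \<open>s\<close>.\<close>

lemma in_ellentuck_closure:
  assumes "w \<in> inf_seqs S v"
    and "\<And>n. n \<ge> N \<Longrightarrow> basic_set S v (prefix n w) (suffix n w) \<inter> U \<noteq> {}"
  shows "w \<in> ellentuck S v closure_of U"
proof -
  have "w \<in> basic_set S v [] w" "[] \<in> fin_seqs S v"
    using reduction_refl[OF assms(1)] by (simp_all add: basic_set_eq fin_seqs_def)
  then have "w \<in> topspace (ellentuck S v)"
    unfolding ellentuck_def topology_generated_by_topspace using assms(1) by blast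
  moreover have "\<exists>y. y \<in> U \<and> y \<in> T" if T: "w \<in> T" "openin (ellentuck S v) T" for T
  proof -
    obtain M where "\<And>n. n \<ge> M \<Longrightarrow> basic_set S v (prefix n w) (suffix n w) \<subseteq> T"
      using openin_ellentuckD[OF T(2,1)] by blast
    then show ?thesis
      using assms(2)[of "max M N"] by (meson disjoint_iff max.cobounded1 max.cobounded2 subsetD)
  qed
  ultimately show ?thesis
    unfolding in_closure_of by blast
qed

section \<open>Ranks of trees of word sequences\<close>

function rank_ge :: "'b list set \<Rightarrow> cord \<Rightarrow> 'b list \<Rightarrow> bool" where
  "rank_ge T \<alpha> t \<longleftrightarrow> (\<forall>\<beta>. \<beta> < \<alpha> \<longrightarrow> (\<exists>w. t @ [w] \<in> T \<and> rank_ge T \<beta> (t @ [w])))"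
  by pat_completeness auto
termination
proof (relation "inv_image {(x, y). x < y} (\<lambda>(_, \<alpha>, _). \<alpha>)")
  show "wf (inv_image {(x, y :: cord). x < y} (\<lambda>(_ :: 'b list set, \<alpha>, _ :: 'b list). \<alpha>))"
    by (intro wf_inv_image wf)
qed auto

declare rank_ge.simps [simp del]

lemma rank_ge_le: "rank_ge T \<alpha> t \<Longrightarrow> \<beta> \<le> \<alpha> \<Longrightarrow> rank_ge T \<beta> t"
  by (subst rank_ge.simps, subst (asm) rank_ge.simps) (meson less_le_trans)

text \<open>Each node has countably many successors, and countably many countable ordinals have a
  countable upper bound; well-founded induction carries such bounds from the successors to the
  node.\<close>

lemma ex_not_rank_ge:
  assumes "wf {(t @ [w], t) | t w. t @ [w] \<in> T}" "countable T"
  shows "\<exists>\<rho>. \<not> rank_ge T \<rho> t"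
  using assms(1)
proof (induction t rule: wf_induct_rule)
  case (less t)
  define W where "W = {w. t @ [w] \<in> T}"
  have "W \<subseteq> last ` T"
    by (force simp: W_def image_iff)
  then have "countable W"
    using assms(2) countable_image countable_subset by blast
  have "\<exists>\<rho>. \<not> rank_ge T \<rho> (t @ [w])" if "w \<in> W" for w
    using that by (intro less) (simp add: W_def)
  then obtain \<rho> where \<rho>: "\<And>w. w \<in> W \<Longrightarrow> \<not> rank_ge T (\<rho> w) (t @ [w])"
    by metis
  obtain \<beta> where \<beta>: "\<And>w. w \<in> W \<Longrightarrow> \<rho> w < \<beta>"
    using countable_imp_ex_upper[of "\<rho> ` W"] \<open>countable W\<close> by auto
  have "\<not> rank_ge T (succ \<beta>) t"
  proof
    assume "rank_ge T (succ \<beta>) t"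
    then obtain w where w: "t @ [w] \<in> T" "rank_ge T \<beta> (t @ [w])"
      using less_succ[of \<beta>] by (subst (asm) rank_ge.simps) blast
    then have "w \<in> W"
      by (simp add: W_def)
    then show False
      using \<rho> \<beta> rank_ge_le[OF w(2)] by (meson less_imp_le)
  qed
  then show ?case
    by blast
qed

text \<open>A recursive form of d with the first position as a parameter: peeling off a word removes
  the least position, which matches \<open>slice\<close>.\<close>

fun starts :: "nat \<Rightarrow> 'b list list \<Rightarrow> nat set" where
  "starts n [] = {}"
| "starts n (a # r) = insert n (starts (n + length a) r)"

lemma starts_eq: "starts n ws = {n + sum_list (map length (take i ws)) | i. i < length ws}"
proof (induction ws arbitrary: n)
  case (Cons a ws)
  then show ?case
    by (simp add: setcompr_eq_image lessThan_def[symmetric] lessThan_Suc_eq_insert_0 image_image add.assoc)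
qed simp

lemma start_positions_Cons: "start_positions (a # r) = starts (1 + length a) r"
  unfolding start_positions_def starts_eq
  by (auto simp: Suc_le_eq gr0_conv_Suc) (metis Suc_less_eq take_Suc_Cons list.simps(9) sum_list.Cons add.assoc)+

lemma starts_ge: "x \<in> starts n ws \<Longrightarrow> n \<le> x"
  by (auto simp: starts_eq)

text \<open>Slices and nodes are descended in parallel: \<open>E\<close> holds the sets of starting
  positions still admissible after \<open>t\<close>. Counting begins with the second word of
  \<open>y\<close>, because the start of \<open>y 0\<close> either has been removed by a slice
  already or is the position 1 that d omits.\<close>

lemma rank_ge_long:
  assumes u: "u \<in> inf_seqs S v"
    and T: "\<And>m t r. fred S v (prefix m u) t \<Longrightarrow> t @ r \<in> F \<Longrightarrow> t \<in> T"
    and "long \<alpha> E" "fred S v (prefix m u) t"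
    and "\<And>y. reduction S v y (suffix m u) \<Longrightarrow> \<exists>j. t @ prefix (Suc j) y \<in> F \<and>
      starts (1 + length (concat t) + length (y 0)) (subsequence y 1 (Suc j)) \<in> E"
  shows "rank_ge T \<alpha> t"
  using assms(3-5)
proof (induction \<alpha> arbitrary: E m t rule: less_induct)
  case (less \<alpha>)
  have "\<exists>w. t @ [w] \<in> T \<and> rank_ge T \<beta> (t @ [w])" if b: "\<beta> < \<alpha>" for \<beta>
  proof -
    obtain n0 where ne: "{} \<notin> E" and n0: "\<And>n. n \<ge> n0 \<Longrightarrow> long \<beta> (slice n E)"
      using longD[OF less.prems(1) b] by blast
    define z where "z = suffix m u"
    have z: "z \<in> inf_seqs S v"
      unfolding z_def using u by (rule suffix_inf_seqs)
    \<comment> \<open>\<open>Suc n0\<close> consecutive words joined with the variable kept form one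
      word of length at least \<open>n0\<close>, so the next start \<open>n\<close> is large enough
      for the bound on \<open>slice n E\<close>.\<close>
    define w where "w = concat (prefix (Suc n0) z)"
    have fw: "fred S v (prefix (Suc n0) z) [w]"
    proof -
      have "replicate (Suc n0) v \<in> var_words S v"
        by (auto simp: var_words_def)
      moreover have "inst v (replicate k v) (prefix k z) = concat (prefix k z)" for k
      proof (induction k)
        case (Suc k)
        have "replicate (Suc k) v = replicate k v @ [v]"
          by (simp add: replicate_append_same)
        then show ?case
          using Suc by (simp add: inst_append del: replicate_Suc)
      qed simp
      ultimately show ?thesis
        using fredI[of "[replicate (Suc n0) v]" S v "prefix (Suc n0) z"]
        by (simp add: fin_seqs_def w_def del: replicate_Suc subseq_to_Suc)
    qed
    have lw: "length w \<ge> n0"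
    proof -
      have "k \<le> length (concat (prefix k z))" for k
      proof (induction k)
        case (Suc k)
        have "z k \<noteq> []"
          using z by (auto simp: inf_seqs_def var_words_def)
        then have "1 \<le> length (z k)"
          by (simp add: Suc_le_eq)
        then show ?case
          using Suc by simp
      qed simp
      from this[of "Suc n0"] show ?thesis
        by (simp add: w_def)
    qed
    define l where "l = m + Suc n0"
    have fl: "fred S v (prefix l u) (t @ [w])"
      using fred_append[OF less.prems(2) fw] subsequence_append[where i = m and j = "Suc n0" and w = u]
      by (simp add: l_def z_def del: subseq_to_Suc)
    define n where "n = 1 + length (concat (t @ [w]))"
    have H: "\<exists>j. (t @ [w]) @ prefix (Suc j) y \<in> F \<and>
      starts (n + length (y 0)) (subsequence y 1 (Suc j)) \<in> slice n E"
      if y: "reduction S v y (suffix l u)" for y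
    proof -
      have "reduction S v y (suffix (Suc n0) z)"
        using y by (simp add: l_def z_def add.commute)
      with reduction_conc[OF z fw] have "reduction S v ([w] \<frown> y) (suffix m u)"
        by (simp only: z_def)
      then obtain j where j: "t @ prefix (Suc j) ([w] \<frown> y) \<in> F"
        "starts (1 + length (concat t) + length (([w] \<frown> y) 0)) (subsequence ([w] \<frown> y) 1 (Suc j)) \<in> E"
        using less.prems(3) by blast
      have pre: "prefix (Suc j) ([w] \<frown> y) = [w] @ prefix j y"
        using prefix_conc_snd[of "[w]" "Suc j" y] by (simp del: build_cons subseq_to_Suc)
      have "subsequence ([w] \<frown> y) 1 (Suc j) = drop 1 (prefix (Suc j) ([w] \<frown> y))"
        by (simp only: subsequence_drop add_0)
      also have "\<dots> = prefix j y"
        unfolding pre by simp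
      finally have sub: "subsequence ([w] \<frown> y) 1 (Suc j) = prefix j y" .
      have E: "starts n (prefix j y) \<in> E"
        using j(2) unfolding sub by (simp add: n_def)
      \<comment> \<open>If \<open>j\<close> were 0, no start would remain and the empty set would
        belong to \<open>E\<close>. Hence the sequence does not stop at \<open>w\<close>, and
        \<open>n\<close> is the least of the remaining starts.\<close>
      have "j \<noteq> 0"
        using E ne by (intro notI) simp
      then obtain i where i: "j = Suc i"
        by (cases j) auto
      have split: "prefix (Suc i) y = y 0 # subsequence y 1 (Suc i)"
        using subsequence_append[where i = 1 and j = i and w = y] by (simp del: subseq_to_Suc)
      have "y 0 \<noteq> []"
        using reduction_inf_seqs(1)[OF y] by (auto simp: inf_seqs_def var_words_def)
      then have "n < n + length (y 0)"
        by simp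
      then have "set_less {n} (starts (n + length (y 0)) (subsequence y 1 (Suc i)))"
        unfolding set_less_def using starts_ge less_le_trans by blast
      then have "starts (n + length (y 0)) (subsequence y 1 (Suc i)) \<in> slice n E"
        using E unfolding i split by (simp add: slice_def)
      moreover have "(t @ [w]) @ prefix (Suc i) y \<in> F"
        using j(1) unfolding pre unfolding i by simp
      ultimately show ?thesis
        by blast
    qed
    have "reduction S v (suffix l u) (suffix l u)"
      using suffix_inf_seqs[OF u] by (rule reduction_refl)
    then obtain j where "(t @ [w]) @ prefix (Suc j) (suffix l u) \<in> F"
      using H by blast
    then have "t @ [w] \<in> T"
      by (rule T[OF fl])
    moreover have "rank_ge T \<beta> (t @ [w])"
    proof (rule less.IH[OF b _ fl])
      show "long \<beta> (slice n E)"
        using lw by (intro n0) (simp add: n_def)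
      show "\<exists>j. (t @ [w]) @ prefix (Suc j) y \<in> F \<and>
          starts (1 + length (concat (t @ [w])) + length (y 0)) (subsequence y 1 (Suc j)) \<in> slice n E"
        if "reduction S v y (suffix l u)" for y
        using H[OF that] unfolding n_def .
    qed
    ultimately show ?thesis
      by blast
  qed
  then show ?case
    by (subst rank_ge.simps) blast
qed


section \<open>The alternative between the closure and a well-founded tree\<close>

lemma ellentuck_dichotomy:
  assumes "finite S" "v \<notin> S" "x \<in> inf_seqs S v" "s \<in> fin_seqs S v"
  shows "(\<exists>u. reduction S v u x \<and> basic_set S v s u \<subseteq> ellentuck S v closure_of U) \<or>
    (\<exists>u. reduction S v u x \<and> (\<exists>T. T \<subseteq> fin_seqs S v \<and>
      wf {(t @ [w], t) | t w. t @ [w] \<in> T} \<and>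
      (\<forall>m t r. fred S v (prefix m u) t \<longrightarrow> t @ r \<in> T \<longrightarrow> t \<in> T) \<and>
      (\<forall>y n. reduction S v y u \<longrightarrow> prefix n y \<notin> T \<longrightarrow>
        basic_set S v (s @ prefix n y) (suffix n y) \<inter> U = {})))"
proof -
  define D where "D t y \<longleftrightarrow> basic_set S v (s @ t) y \<inter> U = {}" for t y
  have D_mono: "D t y'" if "D t y" "reduction S v y' y" for t y y'
    using that basic_set_mono[of S v y' y "s @ t"] unfolding D_def by blast
  \<comment> \<open>Missing \<open>U\<close> is hereditary, so \<open>P\<close> says that it either
    holds at \<open>y\<close> already or cannot be attained by any further reduction.\<close>
  define P where "P t y \<longleftrightarrow> D t y \<or> (\<forall>y'. reduction S v y' y \<longrightarrow> \<not> D t y')" for t y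
  have P_mono: "P t y'" if "P t y" and y': "reduction S v y' y" for t y y'
  proof (cases "D t y")
    case True
    then show ?thesis
      using D_mono[OF _ y'] by (simp add: P_def)
  next
    case False
    then have "\<forall>z. reduction S v z y \<longrightarrow> \<not> D t z"
      using that(1) by (simp add: P_def)
    then have "\<not> D t z" if "reduction S v z y'" for z
      using reduction_trans[OF that y'] by simp
    then show ?thesis
      by (simp add: P_def)
  qed
  have P_dense: "\<exists>y'. reduction S v y' y \<and> P t y'" if y: "y \<in> inf_seqs S v" for t y
  proof (cases "\<exists>y'. reduction S v y' y \<and> D t y'")
    case True
    then show ?thesis
      by (auto simp: P_def)
  next
    case False
    then have "P t y"
      by (simp add: P_def)
    then show ?thesis
      using reduction_refl[OF y] by (intro exI[of _ y]) simp
  qed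
  obtain u where u: "reduction S v u x" "\<And>m t. fred S v (prefix m u) t \<Longrightarrow> P t (suffix m u)"
  proof (rule fusion[OF assms(1,3), where P = P])
    fix t y y' assume "P t y" "reduction S v y' y"
    then show "P t y'"
      by (rule P_mono)
  next
    fix t y assume "y \<in> inf_seqs S v"
    then show "\<exists>y'. reduction S v y' y \<and> P t y'"
      by (rule P_dense)
  qed (rule that)
  have u_inf: "u \<in> inf_seqs S v"
    using u(1) by (rule reduction_inf_seqs(1))
  define T where "T = {t. \<exists>m. fred S v (prefix m u) t \<and> \<not> D t (suffix m u)}"
  have notT: "D (prefix n y) (suffix n y)" if y: "reduction S v y u" and n: "prefix n y \<notin> T" for y n
  proof -
    obtain m where m: "fred S v (prefix m u) (prefix n y)" "reduction S v (suffix n y) (suffix m u)"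
      by (rule reduction_suffixE[OF y])
    have "D (prefix n y) (suffix m u)"
      using n m(1) by (simp add: T_def)
    then show ?thesis
      using m(2) by (rule D_mono)
  qed
  have inT: "\<not> D (prefix n y) (suffix n y)" if y: "reduction S v y u" and n: "prefix n y \<in> T" for y n
  proof -
    obtain m where m: "fred S v (prefix m u) (prefix n y)" "\<not> D (prefix n y) (suffix m u)"
      using n by (auto simp: T_def)
    have "P (prefix n y) (suffix m u)"
      using m(1) by (rule u(2))
    then have "\<forall>z. reduction S v z (suffix m u) \<longrightarrow> \<not> D (prefix n y) z"
      using m(2) by (simp add: P_def)
    then show ?thesis
      using reduction_suffix_fred[OF y m(1)] by simp
  qed
  have T_hered: "t \<in> T" if tr: "t @ r \<in> T" for t r
  proof -
    obtain m where m: "fred S v (prefix m u) (t @ r)" "\<not> D (t @ r) (suffix m u)"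
      using tr by (auto simp: T_def)
    obtain l where l: "l \<le> m" "fred S v (prefix l u) t" "fred S v (subsequence u l m) r"
      using m(1) by (rule fred_prefix_splitE)
    have eq: "suffix (m - l) (suffix l u) = suffix m u" "prefix (m - l) (suffix l u) = subsequence u l m"
      using l(1) by simp_all
    have t: "t \<in> fin_seqs S v"
      using l(2) prefix_fin_seqs[OF u_inf] by (rule fred_fin_seqs)
    then have st: "s @ t \<in> fin_seqs S v"
      using assms(4) by (simp add: fin_seqs_def)
    have "fred S v (prefix (m - l) (suffix l u)) r"
      using l(3) by (simp only: eq)
    from basic_set_extend[OF st suffix_inf_seqs[OF u_inf] this]
    have "basic_set S v ((s @ t) @ r) (suffix m u) \<subseteq> basic_set S v (s @ t) (suffix l u)"
      by (simp only: eq)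
    then have "\<not> D t (suffix l u)"
      using m(2) unfolding D_def append_assoc by blast
    then show ?thesis
      using l(2) by (auto simp: T_def)
  qed
  obtain u1 where u1: "reduction S v u1 u"
    "(\<forall>y. reduction S v y u1 \<longrightarrow> (\<exists>n. prefix n y \<in> - T)) \<or>
     (\<forall>y n. reduction S v y u1 \<longrightarrow> prefix n y \<notin> - T)"
    by (rule nash_williams[OF assms(1,2) u_inf])
  have u1x: "reduction S v u1 x"
    using u1(1) u(1) by (rule reduction_trans)
  have u1_inf: "u1 \<in> inf_seqs S v"
    using u1(1) by (rule reduction_inf_seqs(1))
  from u1(2) show ?thesis
  proof
    assume none: "\<forall>y n. reduction S v y u1 \<longrightarrow> prefix n y \<notin> - T"
    have "basic_set S v s u1 \<subseteq> ellentuck S v closure_of U"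
    proof
      fix w assume "w \<in> basic_set S v s u1"
      then obtain y where y: "w = s \<frown> y" "reduction S v y u1"
        unfolding basic_set_eq[OF assms(4)] by blast
      have yu: "reduction S v y u"
        using y(2) u1(1) by (rule reduction_trans)
      show "w \<in> ellentuck S v closure_of U"
      proof (rule in_ellentuck_closure)
        show "w \<in> inf_seqs S v"
          unfolding y(1) using assms(4) reduction_inf_seqs(1)[OF y(2)] by (rule conc_inf_seqs)
        fix n assume n: "length s \<le> n"
        have "prefix (n - length s) y \<in> T"
          using none y(2) by simp
        then have "\<not> D (prefix (n - length s) y) (suffix (n - length s) y)"
          by (rule inT[OF yu])
        moreover have "prefix n w = s @ prefix (n - length s) y" "suffix n w = suffix (n - length s) y"
          unfolding y(1) using n by (rule prefix_conc_snd, rule suffix_conc_snd)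
        ultimately show "basic_set S v (prefix n w) (suffix n w) \<inter> U \<noteq> {}"
          by (simp only: D_def not_False_eq_True)
      qed
    qed
    then show ?thesis
      using u1x by blast
  next
    assume all: "\<forall>y. reduction S v y u1 \<longrightarrow> (\<exists>n. prefix n y \<in> - T)"
    \<comment> \<open>Restriction to finite reducts of \<open>u1\<close> makes every infinite branch
      a reduction of \<open>u1\<close>, for which \<open>all\<close> provides a prefix outside
      \<open>T\<close>.\<close>
    define T1 where "T1 = {t \<in> T. \<exists>m. fred S v (prefix m u1) t}"
    have T1_fin: "T1 \<subseteq> fin_seqs S v"
      by (auto simp: T1_def intro: fred_fin_seqs[OF _ prefix_fin_seqs[OF u1_inf]])
    have hered: "t \<in> T1" if "t @ r \<in> T1" for t r
    proof -
      obtain m where "fred S v (prefix m u1) (t @ r)"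
        using \<open>t @ r \<in> T1\<close> by (auto simp: T1_def)
      then obtain l where "fred S v (prefix l u1) t"
        by (rule fred_prefix_splitE)
      moreover have "t \<in> T"
        using \<open>t @ r \<in> T1\<close> T_hered[of t r] by (simp add: T1_def)
      ultimately show ?thesis
        by (auto simp: T1_def)
    qed
    have wf: "wf {(t @ [w], t) | t w. t @ [w] \<in> T1}"
      unfolding wf_iff_no_infinite_down_chain
    proof
      assume "\<exists>f. \<forall>i. (f (Suc i), f i) \<in> {(t @ [w], t) | t w. t @ [w] \<in> T1}"
      then obtain f where chain: "\<forall>i. (f (Suc i), f i) \<in> {(t @ [w], t) | t w. t @ [w] \<in> T1}"
        by blast
      have f: "\<exists>w. f (Suc i) = f i @ [w] \<and> f (Suc i) \<in> T1" for i
        using chain[rule_format, of i] by auto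
      have len: "i \<le> length (f i)" for i
      proof (induction i)
        case (Suc i)
        then show ?case
          using f[of i] by auto
      qed simp
      \<comment> \<open>The chain need not start at the empty sequence. The estimate
        \<open>len\<close> together with heredity puts every prefix of the limit \<open>y\<close>
        into \<open>T1\<close>.\<close>
      define y where "y i = f (Suc i) ! i" for i
      have pre: "prefix i y = take i (f i)" for i
      proof (induction i)
        case (Suc i)
        have "take i (f (Suc i)) = take i (f i)"
          using f[of i] len[of i] by auto
        moreover have "take (Suc i) (f (Suc i)) = take i (f (Suc i)) @ [f (Suc i) ! i]"
          using len[of "Suc i"] by (intro take_Suc_conv_app_nth) simp
        ultimately show ?case
          using Suc by (simp add: y_def)
      qed simp
      have T1: "prefix i y \<in> T1" for i
      proof -
        have "f (Suc i) \<in> T1"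
          using f by blast
        then have "prefix (Suc i) y \<in> T1"
          using hered[of "take (Suc i) (f (Suc i))" "drop (Suc i) (f (Suc i))"]
          by (simp only: pre append_take_drop_id)
        then show ?thesis
          using hered[of "prefix i y" "[y i]"] by simp
      qed
      have "y \<in> inf_seqs S v"
        unfolding inf_seqs_def
      proof safe
        fix i
        have "prefix (Suc i) y \<in> fin_seqs S v"
          using T1 T1_fin by blast
        then show "y i \<in> var_words S v"
          by (simp add: fin_seqs_def)
      qed
      moreover have "\<exists>m. fred S v (prefix m u1) (prefix n y)" for n
        using T1[of n] by (simp add: T1_def)
      ultimately have "reduction S v y u1"
        using u1_inf by (simp add: reduction_iff)
      then obtain n where "prefix n y \<in> - T"
        using all by blast
      then show False
        using T1[of n] by (simp add: T1_def)
    qed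
    have "basic_set S v (s @ prefix n y) (suffix n y) \<inter> U = {}"
      if y: "reduction S v y u1" and n: "prefix n y \<notin> T1" for y n
    proof -
      obtain m where "fred S v (prefix m u1) (prefix n y)"
        by (rule reduction_suffixE[OF y])
      then have "prefix n y \<notin> T"
        using n by (auto simp: T1_def)
      then show ?thesis
        using notT[OF reduction_trans[OF y u1(1)]] by (simp add: D_def)
    qed
    then show ?thesis
      using u1x T1_fin wf hered by (intro disjI2 exI[of _ u1] exI[of _ T1] conjI) auto
  qed
qed

theorem theorem5p2:
  fixes S :: "'a set" and v :: 'a
    and L :: "cord \<Rightarrow> nat \<Rightarrow> cord"
    and U :: "(nat \<Rightarrow> 'a list) set"
    and s :: "'a list list" and x :: "nat \<Rightarrow> 'a list"
  assumes "finite S" "S \<noteq> {}" "v \<notin> S"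
    and "fundamental_system L"
    and "U \<subseteq> inf_seqs S v"
    and "s \<in> fin_seqs S v"
    and "x \<in> inf_seqs S v"
  shows "(\<exists>u. reduction S v u x \<and> basic_set S v s u \<subseteq> ellentuck S v closure_of U) \<or>
    (\<exists>\<xi>\<^sub>0. \<forall>\<xi>>\<xi>\<^sub>0. \<exists>u. reduction S v u x \<and>
      (\<forall>y t. reduction S v y u \<and> t \<in> schreier_seqs L S v \<xi> \<and> initial_segment t y \<longrightarrow>
        basic_set S v (s @ t) (seq_minus y t) \<subseteq> inf_seqs S v - U))"
  using ellentuck_dichotomy[OF assms(1,3,7,6), of U]
proof (elim disjE exE conjE)
  fix u T
  assume ux: "reduction S v u x" and T: "T \<subseteq> fin_seqs S v"
    and wf: "wf {(t @ [w], t) | t w. t @ [w] \<in> T}"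
    and hered: "\<forall>m t r. fred S v (prefix m u) t \<longrightarrow> t @ r \<in> T \<longrightarrow> t \<in> T"
    and notT: "\<forall>y n. reduction S v y u \<longrightarrow> prefix n y \<notin> T \<longrightarrow>
      basic_set S v (s @ prefix n y) (suffix n y) \<inter> U = {}"
  have "countable T"
  proof (rule countable_subset[OF T])
    have "var_words S v \<subseteq> lists (insert v S)"
      by (auto simp: var_words_def)
    moreover have "countable (insert v S)"
      using assms(1) by (simp add: countable_finite)
    ultimately have "countable (var_words S v)"
      using countable_lists countable_subset by blast
    then show "countable (fin_seqs S v)"
      unfolding fin_seqs_def by (rule countable_lists)
  qed
  then obtain \<rho> where \<rho>: "\<not> rank_ge T \<rho> []"
    using ex_not_rank_ge[OF wf] by blast
  \<comment> \<open>The witness for \<open>\<xi>\<^sub>0\<close> is \<open>omega_pow \<rho>\<close>,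
    with \<open>\<rho>\<close> an ordinal that the rank of the root of \<open>T\<close> does not
    reach.\<close>
  have "\<exists>u. reduction S v u x \<and>
      (\<forall>y t. reduction S v y u \<and> t \<in> schreier_seqs L S v \<xi> \<and> initial_segment t y \<longrightarrow>
        basic_set S v (s @ t) (seq_minus y t) \<subseteq> inf_seqs S v - U)" if \<xi>: "omega_pow \<rho> < \<xi>" for \<xi>
  proof -
    have \<xi>0: "\<xi> \<noteq> 0"
      using \<xi> by auto
    \<comment> \<open>Intersecting with \<open>T\<close> makes all initial segments of members that
      are reducts of \<open>u2\<close> nodes of \<open>T\<close>, as \<open>rank_ge_long\<close>
      requires. The negative alternative says that members of W^xi met along reductions of
      \<open>u2\<close> lie outside \<open>T\<close>.\<close>
    obtain u2 where u2: "reduction S v u2 u"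
      "(\<forall>y. reduction S v y u2 \<longrightarrow> (\<exists>n. prefix n y \<in> schreier_seqs L S v \<xi> \<inter> T)) \<or>
       (\<forall>y n. reduction S v y u2 \<longrightarrow> prefix n y \<notin> schreier_seqs L S v \<xi> \<inter> T)"
      by (rule nash_williams[OF assms(1,3) reduction_inf_seqs(1)[OF ux]])
    have u2_inf: "u2 \<in> inf_seqs S v"
      using u2(1) by (rule reduction_inf_seqs(1))
    have "\<not> (\<forall>y. reduction S v y u2 \<longrightarrow> (\<exists>n. prefix n y \<in> schreier_seqs L S v \<xi> \<inter> T))"
    proof
      assume all: "\<forall>y. reduction S v y u2 \<longrightarrow> (\<exists>n. prefix n y \<in> schreier_seqs L S v \<xi> \<inter> T)"
      have "rank_ge T \<rho> []"
      proof (rule rank_ge_long[OF u2_inf, where m = 0 and F = "schreier_seqs L S v \<xi> \<inter> T"])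
        show "long \<rho> {s. schreier L \<xi> s}"
          using assms(4) \<xi> by (intro long_schreier) simp_all
      next
        fix m t r assume t: "fred S v (prefix m u2) t" and tr: "t @ r \<in> schreier_seqs L S v \<xi> \<inter> T"
        obtain l where "fred S v (prefix l u) (prefix m u2)"
          by (rule reduction_suffixE[OF u2(1)])
        then have "fred S v (prefix l u) t"
          using t by (rule fred_trans)
        then show "t \<in> T"
          using hered tr by blast
      next
        fix y assume "reduction S v y (suffix 0 u2)"
        then obtain n where n: "prefix n y \<in> schreier_seqs L S v \<xi>" "prefix n y \<in> T"
          using all by auto
        then have "n \<noteq> 0"
          using \<xi>0 by (auto simp: schreier_seqs_def)
        then obtain j where j: "n = Suc j"
          by (cases n) auto
        have split: "prefix (Suc j) y = y 0 # subsequence y 1 (Suc j)"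
          using subsequence_append[where i = 1 and j = j and w = y] by (simp del: subseq_to_Suc)
        have "starts (1 + length (y 0)) (subsequence y 1 (Suc j)) \<in> {s. schreier L \<xi> s}"
          using n(1) \<xi>0 unfolding j split by (simp add: schreier_seqs_def start_positions_Cons del: subseq_to_Suc)
        then show "\<exists>j. [] @ prefix (Suc j) y \<in> schreier_seqs L S v \<xi> \<inter> T \<and>
            starts (1 + length (concat []) + length (y 0)) (subsequence y 1 (Suc j)) \<in> {s. schreier L \<xi> s}"
          using n unfolding j by (intro exI[of _ j]) simp
      qed simp
      then show False
        using \<rho> by blast
    qed
    then have none: "\<forall>y n. reduction S v y u2 \<longrightarrow> prefix n y \<notin> schreier_seqs L S v \<xi> \<inter> T"
      using u2(2) by blast
    have "basic_set S v (s @ t) (seq_minus y t) \<subseteq> inf_seqs S v - U"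
      if y: "reduction S v y u2" and t: "t \<in> schreier_seqs L S v \<xi>" "initial_segment t y" for y t
    proof -
      have pre: "prefix (length t) y = t"
        using t(2) by (simp add: initial_segment_iff)
      have "prefix (length t) y \<notin> T"
        using none y t(1) pre by (metis IntI)
      then have "basic_set S v (s @ t) (seq_minus y t) \<inter> U = {}"
        using notT reduction_trans[OF y u2(1)] unfolding seq_minus_eq by (metis pre)
      then show ?thesis
        by (auto simp: basic_set_def)
    qed
    moreover have "reduction S v u2 x"
      using u2(1) ux by (rule reduction_trans)
    ultimately show ?thesis
      by blast
  qed
  then show ?thesis
    by blast
qed blast

end
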